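(* For every $k \in \mathbb{N}$ there exist constants $c^l_k$ and $c^u_k$ such that for all sufficiently large even $n$, the $k$-th smallest Laplacian eigenvalues (counted with multiplicity) of $\Gamma^l_n$ and $\Gamma^u_n$ satisfy $\lambda_k(\Gamma^l_n) \le c^l_k$ and $\lambda_k(\Gamma^u_n) \le c^u_k$.
   Context: A cubic graph is a connected graph, possibly with loops and multiple edges, in which every vertex has degree $3$ (a loop contributes $2$ to the degree of its vertex). Its vertices may be labelled (an $n$-vertex labelled cubic graph has vertex set $\{1,\dots,n\}$) or unlabelled (cubic graphs are then considered up to isomorphism). Whitehead move: let $e$ be a non-loop edge of a cubic graph with endpoints $u_1 \ne u_2$. Apart from the two halves of $e$, there are two half-edges at $u_1$ and two half-edges at $u_2$. A Whitehead move on $e$ chooses one of the two at $u_1$ and one of the two at $u_2$ and swaps them, i.e. the chosen half-edge at $u_1$ is reattached to $u_2$ and the chosen half-edge at $u_2$ is reattached to $u_1$; everything else is unchanged. (This gives at most $4$ moves on $e$ for labelled graphs and at most $2$ up to isomorphism for unlabelled graphs. The result is again a cubic graph, and Whitehead moves are reversible.) For even $n \in \mathbb{N}$ ($n\ge 2$), $\Gamma^l_n$ (resp. $\Gamma^u_n$) is the simple undirected graph whose vertices are all $n$-vertex labelled (resp. unlabelled) cubic graphs, with two distinct cubic graphs adjacent if and only if one can be transformed into the other by a single Whitehead move. For a finite simple graph $G$ on $N$ vertices, the Laplacian matrix is $Q(G) = D(G) - A(G)$, where $D(G)$ is the diagonal matrix of vertex degrees and $A(G)$ is the adjacency matrix.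 Its eigenvalues, counted with multiplicity, are written $\lambda_1(G) \le \lambda_2(G) \le \cdots \le \lambda_N(G)$. *)

theory Defs
  imports
    "HOL-Library.Multiset"
    "Jordan_Normal_Form.Char_Poly"
begin

section \<open>Cubic graphs\<close>

text \<open>
  A graph with loops and multiple edges is given by the multiset of its edges, an edge being the
  two-element multiset of its endpoints: \<open>{#v, v#}\<close> is a loop at \<open>v\<close>, and multiplicities in the
  outer multiset count parallel edges. Only vertices carry labels, so labelled graphs are equal
  iff their edge multisets are.
\<close>

type_synonym multigraph = "nat multiset multiset"

text \<open>A loop at \<open>v\<close> contributes \<open>count {#v, v#} v = 2\<close>.\<close>

definition vertex_degree :: "multigraph \<Rightarrow> nat \<Rightarrow> nat" where
  "vertex_degree G v = (\<Sum>e\<in>#G. count e v)"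

definition connected_on :: "nat set \<Rightarrow> multigraph \<Rightarrow> bool" where
  "connected_on V G \<longleftrightarrow> (\<forall>u\<in>V. \<forall>v\<in>V. (u, v) \<in> {(x, y). {#x, y#} \<in># G}\<^sup>*)"

definition labelled_cubic_graphs :: "nat \<Rightarrow> multigraph set" where
  "labelled_cubic_graphs n =
     {G. (\<forall>e\<in>#G. size e = 2 \<and> set_mset e \<subseteq> {1..n}) \<and>
         (\<forall>v\<in>{1..n}. vertex_degree G v = 3) \<and>
         connected_on {1..n} G}"

definition iso_rel :: "nat \<Rightarrow> (multigraph \<times> multigraph) set" where
  "iso_rel n =
     {(G, H). G \<in> labelled_cubic_graphs n \<and> H \<in> labelled_cubic_graphs n \<and>
              (\<exists>\<pi>. bij_betw \<pi> {1..n} {1..n} \<and> H = image_mset (image_mset \<pi>) G)}"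

definition unlabelled_cubic_graphs :: "nat \<Rightarrow> multigraph set set" where
  "unlabelled_cubic_graphs n = labelled_cubic_graphs n // iso_rel n"

section \<open>Whitehead moves\<close>

text \<open>
  The move is on the non-loop edge \<open>{#u, v#}\<close>. In the first rule the chosen half-edges at \<open>u\<close> and
  \<open>v\<close> belong to different edges \<open>{#u, a#}\<close> and \<open>{#v, b#}\<close>; the vertices \<open>a\<close> and \<open>b\<close> may well be
  \<open>u\<close> or \<open>v\<close> (half of a loop, or half of an edge parallel to \<open>{#u, v#}\<close>). In the second rule they
  are the two halves of a single edge parallel to \<open>{#u, v#}\<close>, and swapping them changes nothing.
\<close>

inductive whitehead_move :: "multigraph \<Rightarrow> multigraph \<Rightarrow> bool" where
  two_edges: "u \<noteq> v \<Longrightarrow>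
    whitehead_move ({#{#u, v#}, {#u, a#}, {#v, b#}#} + R) ({#{#u, v#}, {#v, a#}, {#u, b#}#} + R)"
| one_edge: "u \<noteq> v \<Longrightarrow>
    whitehead_move ({#{#u, v#}, {#u, v#}#} + R) ({#{#u, v#}, {#v, u#}#} + R)"

section \<open>The graphs of cubic graphs\<close>

text \<open>A simple undirected graph; its edges are two-element sets of vertices.\<close>

record 'a simple_graph =
  verts :: "'a set"
  edges :: "'a set set"

definition Gamma_l :: "nat \<Rightarrow> multigraph simple_graph" where
  "Gamma_l n =
     \<lparr>verts = labelled_cubic_graphs n,
      edges = {{G, H} | G H. G \<in> labelled_cubic_graphs n \<and> H \<in> labelled_cubic_graphs n \<and>
                 G \<noteq> H \<and> whitehead_move G H}\<rparr>"

definition Gamma_u :: "nat \<Rightarrow> multigraph set simple_graph" where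
  "Gamma_u n =
     \<lparr>verts = unlabelled_cubic_graphs n,
      edges = {{C, D} | C D. C \<in> unlabelled_cubic_graphs n \<and> D \<in> unlabelled_cubic_graphs n \<and>
                 C \<noteq> D \<and> (\<exists>G\<in>C. \<exists>H\<in>D. whitehead_move G H)}\<rparr>"

section \<open>Laplacian eigenvalues\<close>

text \<open>
  Rows and columns follow some enumeration \<open>xs\<close> of the vertices; the spectrum does not depend on
  which one.
\<close>

definition degree_matrix :: "'a simple_graph \<Rightarrow> 'a list \<Rightarrow> real mat" where
  "degree_matrix G xs = mat (length xs) (length xs)
     (\<lambda>(i, j). if i = j then real (card {w \<in> verts G. {xs ! i, w} \<in> edges G}) else 0)"

definition adjacency_matrix :: "'a simple_graph \<Rightarrow> 'a list \<Rightarrow> real mat" where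
  "adjacency_matrix G xs = mat (length xs) (length xs)
     (\<lambda>(i, j). if {xs ! i, xs ! j} \<in> edges G then 1 else 0)"

definition laplacian_matrix :: "'a simple_graph \<Rightarrow> real mat" where
  "laplacian_matrix G =
     (let xs = (SOME xs. distinct xs \<and> set xs = verts G)
      in degree_matrix G xs - adjacency_matrix G xs)"

definition laplacian_spectrum :: "'a simple_graph \<Rightarrow> real list" where
  "laplacian_spectrum G = sorted_list_of_multiset (proots (char_poly (laplacian_matrix G)))"

text \<open>\<open>laplacian_eigenvalue k G\<close> is $\lambda_k(G)$, for \<open>1 \<le> k \<le> card (verts G)\<close>.\<close>

definition laplacian_eigenvalue :: "nat \<Rightarrow> 'a simple_graph \<Rightarrow> real" where
  "laplacian_eigenvalue k G = laplacian_spectrum G ! (k - 1)"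

section \<open>Well-definedness\<close>

lemma sum_vertex_degree:
  assumes "finite V" and "\<forall>e\<in>#G. size e = 2 \<and> set_mset e \<subseteq> V"
  shows "(\<Sum>v\<in>V. vertex_degree G v) = 2 * size G"
  using assms(2)
proof (induction G)
  case empty
  then show ?case by (simp add: vertex_degree_def)
next
  case (add e G)
  have "(\<Sum>v\<in>V. count e v) = (\<Sum>v\<in>set_mset e. count e v)"
    using add.prems assms(1) by (intro sum.mono_neutral_right) (auto simp: not_in_iff)
  also have "\<dots> = 2"
    using add.prems by (simp add: size_multiset_overloaded_eq)
  finally show ?case
    using add by (simp add: vertex_degree_def sum.distrib)
qed

lemma finite_labelled_cubic_graphs: "finite (labelled_cubic_graphs n)"
proof (rule finite_subset)
  let ?E = "multisets_of_size {1..n} 2"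
  show "labelled_cubic_graphs n \<subseteq> (\<Union>m\<in>{..3 * n}. multisets_of_size ?E m)"
  proof
    fix G assume G: "G \<in> labelled_cubic_graphs n"
    then have "2 * size G = (\<Sum>v\<in>{1..n}. vertex_degree G v)"
      by (intro sum_vertex_degree[symmetric]) (auto simp: labelled_cubic_graphs_def)
    also have "\<dots> = 3 * n"
      using G by (simp add: labelled_cubic_graphs_def)
    finally have "size G \<le> 3 * n" by simp
    then show "G \<in> (\<Union>m\<in>{..3 * n}. multisets_of_size ?E m)"
      using G by (auto simp: labelled_cubic_graphs_def multisets_of_size_def)
  qed
  show "finite (\<Union>m\<in>{..3 * n}. multisets_of_size ?E m)"
    by (intro finite_UN_I finite_multisets_of_size) auto
qed

lemma equiv_iso_rel: "equiv (labelled_cubic_graphs n) (iso_rel n)"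
proof (rule equivI)
  show "iso_rel n \<subseteq> labelled_cubic_graphs n \<times> labelled_cubic_graphs n"
    by (auto simp: iso_rel_def)
  show "refl_on (labelled_cubic_graphs n) (iso_rel n)"
    by (auto simp: iso_rel_def intro!: refl_onI exI[of _ id])
  show "sym (iso_rel n)"
  proof (rule symI)
    fix G H assume "(G, H) \<in> iso_rel n"
    then obtain \<pi> where G: "G \<in> labelled_cubic_graphs n" and H: "H \<in> labelled_cubic_graphs n"
      and \<pi>: "bij_betw \<pi> {1..n} {1..n}" and eq: "H = image_mset (image_mset \<pi>) G"
      by (auto simp: iso_rel_def)
    let ?\<rho> = "inv_into {1..n} \<pi>"
    have "image_mset ?\<rho> (image_mset \<pi> e) = e" if "e \<in># G" for e
    proof -
      have "set_mset e \<subseteq> {1..n}" using G that by (auto simp: labelled_cubic_graphs_def)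
      then have "image_mset (\<lambda>x. ?\<rho> (\<pi> x)) e = image_mset (\<lambda>x. x) e"
        using bij_betw_inv_into_left[OF \<pi>] by (intro image_mset_cong) blast
      then show ?thesis by (simp add: multiset.map_comp comp_def)
    qed
    then have "image_mset (\<lambda>e. image_mset ?\<rho> (image_mset \<pi> e)) G = image_mset (\<lambda>e. e) G"
      by (intro image_mset_cong) blast
    then have "G = image_mset (image_mset ?\<rho>) H"
      by (simp add: eq multiset.map_comp comp_def)
    then show "(H, G) \<in> iso_rel n"
      using G H bij_betw_inv_into[OF \<pi>] by (auto simp: iso_rel_def)
  qed
  show "trans (iso_rel n)"
  proof (rule transI)
    fix G H K assume "(G, H) \<in> iso_rel n" and "(H, K) \<in> iso_rel n"
    then obtain \<pi> \<rho> where G: "G \<in> labelled_cubic_graphs n" and K: "K \<in> labelled_cubic_graphs n"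
      and \<pi>: "bij_betw \<pi> {1..n} {1..n}" and H: "H = image_mset (image_mset \<pi>) G"
      and \<rho>: "bij_betw \<rho> {1..n} {1..n}" and Keq: "K = image_mset (image_mset \<rho>) H"
      by (auto simp: iso_rel_def)
    have "K = image_mset (image_mset (\<rho> \<circ> \<pi>)) G"
      by (simp add: Keq H multiset.map_comp comp_def)
    then show "(G, K) \<in> iso_rel n"
      using G K bij_betw_trans[OF \<pi> \<rho>] by (auto simp: iso_rel_def)
  qed
qed

lemma finite_unlabelled_cubic_graphs: "finite (unlabelled_cubic_graphs n)"
  unfolding unlabelled_cubic_graphs_def
  by (intro finite_quotient finite_labelled_cubic_graphs) (auto simp: iso_rel_def)

lemma symmetric_char_poly_splits:
  fixes A :: "real mat"
  assumes A: "A \<in> carrier_mat n n"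
    and sym: "\<And>i j. i < n \<Longrightarrow> j < n \<Longrightarrow> A $$ (i, j) = A $$ (j, i)"
  obtains rs where "char_poly A = (\<Prod>r\<leftarrow>rs. [:- r, 1:])" and "length rs = n"
proof -
  interpret of_real_poly: map_poly_inj_comm_ring_hom "complex_of_real" ..
  let ?B = "map_mat complex_of_real A"
  have B: "?B \<in> carrier_mat n n" using A by simp
  obtain as where as: "char_poly ?B = (\<Prod>a\<leftarrow>as. [:- a, 1:])" "length as = n"
    using char_poly_factorized[OF B] by blast
  have real: "a \<in> \<real>" if "a \<in> set as" for a
  proof -
    have "poly (char_poly ?B) a = 0"
      unfolding as(1) using that by (induction as) auto
    then have "eigenvalue ?B a" using eigenvalue_root_char_poly[OF B] by blast
    then obtain v where v: "v \<in> carrier_vec n" and v0: "v \<noteq> 0\<^sub>v n" and Bv: "?B *\<^sub>v v = a \<cdot>\<^sub>v v"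
      using B by (auto simp: eigenvalue_def eigenvector_def)
    have cB: "conjugate (?B *\<^sub>v v) = ?B *\<^sub>v conjugate v"
      using A v by (intro eq_vecI) (auto simp: scalar_prod_def sum_conjugate conjugate_dist_mul)
    have tB: "transpose_mat ?B = ?B"
      using A sym by (intro eq_matI) auto
    have "a * (v \<bullet>c v) = (?B *\<^sub>v v) \<bullet> conjugate v"
      using v by (simp add: Bv)
    also have "\<dots> = v \<bullet> (?B *\<^sub>v conjugate v)"
      using transpose_vec_mult_scalar[OF B, of "conjugate v" v] v tB
      by (metis carrier_vec_conjugate)
    also have "\<dots> = v \<bullet> conjugate (a \<cdot>\<^sub>v v)"
      by (simp only: cB[symmetric] Bv)
    also have "\<dots> = cnj a * (v \<bullet>c v)"
      using v by (simp add: conjugate_smult_vec)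
    finally have "a = cnj a"
      using v v0 by simp
    then show ?thesis by (metis Reals_cnj_iff)
  qed
  define rs where "rs = map Re as"
  have as_rs: "as = map complex_of_real rs"
    using real by (auto simp: rs_def comp_def intro!: map_idI[symmetric])
  have "map_poly complex_of_real (char_poly A) = map_poly complex_of_real (\<Prod>r\<leftarrow>rs. [:- r, 1:])"
    unfolding of_real_hom.char_poly_hom[OF A, symmetric] as(1) as_rs
    by (simp add: of_real_poly.hom_prod_list comp_def)
  then have "char_poly A = (\<Prod>r\<leftarrow>rs. [:- r, 1:])"
    by simp
  then show ?thesis using as(2) by (intro that[of rs]) (auto simp: rs_def)
qed

lemma length_laplacian_spectrum:
  assumes "finite (verts G)"
  shows "length (laplacian_spectrum G) = card (verts G)"
proof -
  define xs where "xs = (SOME xs. distinct xs \<and> set xs = verts G)"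
  have xs: "distinct xs \<and> set xs = verts G"
    unfolding xs_def by (rule someI_ex) (use finite_distinct_list[OF assms] in blast)
  define n where "n = card (verts G)"
  have n: "length xs = n"
    using xs distinct_card[of xs] by (simp add: n_def)
  have L: "laplacian_matrix G = degree_matrix G xs - adjacency_matrix G xs"
    by (simp add: laplacian_matrix_def xs_def Let_def)
  have "laplacian_matrix G \<in> carrier_mat n n"
    by (simp add: L n degree_matrix_def adjacency_matrix_def minus_mat_def)
  moreover have "laplacian_matrix G $$ (i, j) = laplacian_matrix G $$ (j, i)" if "i < n" "j < n" for i j
    using that by (simp add: L n degree_matrix_def adjacency_matrix_def insert_commute)
  ultimately obtain rs
    where rs: "char_poly (laplacian_matrix G) = (\<Prod>r\<leftarrow>rs. [:- r, 1:])" "length rs = n"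
    by (rule symmetric_char_poly_splits)
  have "proots (\<Prod>r\<leftarrow>rs. [:- r, 1:]) = mset rs"
  proof (induction rs)
    case (Cons r rs)
    have "(\<Prod>r\<leftarrow>rs. [:- r, 1:]) \<noteq> 0" for rs :: "real list"
      by (induction rs) (simp_all del: mult_pCons_left)
    then have "proots ([:- r, 1:] * (\<Prod>r\<leftarrow>rs. [:- r, 1:])) = {#r#} + mset rs"
      using Cons.IH by (subst proots_mult) auto
    then show ?case by simp
  qed simp
  then show ?thesis
    using rs by (simp add: laplacian_spectrum_def n_def flip: size_mset)
qed

end

theory Submission
  imports Defs "Jordan_Normal_Form.Jordan_Normal_Form_Existence"
begin

text \<open>
  If a graph has \<open>k\<close> disjoint nonempty vertex sets and every element of such a set has at most \<open>C\<close>
  neighbours outside it, then \<open>\<lambda>\<^sub>k \<le> 2 C\<close>: use the span of the indicator functions in the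
  Courant--Fischer principle. For the graphs of cubic graphs, take the sets of cubic graphs that
  have a centroid with a small branch of prescribed odd size \<open>p \<ge> 3\<close>, that is, a vertex whose three
  edges are bridges to branches with \<open>p\<close>, less than \<open>n / 2\<close> and less than \<open>n / 2\<close> vertices. The
  centroid is unique, so different \<open>p\<close> give disjoint sets. A Whitehead move that does not involve
  the centroid happens inside one branch and preserves all this; the other moves only involve
  vertices at distance at most 3 from the centroid, so their number is bounded by a constant. An
  unlabelled graph has no more neighbours than any labelled representative, so the same
  bound holds there.
\<close>

section \<open>Eigenvalues of real symmetric matrices\<close>

text \<open>Induction over the blocks: the off-diagonal quadrants of the block decomposition vanish,
  so a nonzero entry lies inside one block and both diagonal positions carry the same value.
  \<open>symmetric_diagonalizable\<close> needs only this much about the Jordan form.\<close>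

lemma jordan_matrix_nonzero:
  assumes "i < sum_list (map fst n_as)" and "j < sum_list (map fst n_as)"
    and "jordan_matrix n_as $$ (i, j) \<noteq> 0"
  shows "i = j \<or> Suc i = j \<and> jordan_matrix n_as $$ (i, i) = jordan_matrix n_as $$ (j, j)"
  using assms
proof (induction n_as arbitrary: i j)
  case (Cons na n_as)
  obtain m a where na: "na = (m, a)" by force
  let ?s = "sum_list (map fst n_as)"
  have entry: "jordan_matrix (na # n_as) $$ (i, j) =
      (if i < m then if j < m then jordan_block m a $$ (i, j) else 0
       else if j < m then 0 else jordan_matrix n_as $$ (i - m, j - m))"
    if "i < m + ?s" "j < m + ?s" for i j
    using that unfolding na jordan_matrix_Cons
    by (subst index_mat_four_block) auto
  consider "i < m" "j < m" | "\<not> i < m" "\<not> j < m"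
    using Cons.prems entry[of i j] by (auto simp: na split: if_splits)
  then show ?case
  proof cases
    case 1
    then show ?thesis using Cons.prems entry by (auto simp: na split: if_splits)
  next
    case 2
    then have "i - m = j - m \<or> Suc (i - m) = j - m \<and>
        jordan_matrix n_as $$ (i - m, i - m) = jordan_matrix n_as $$ (j - m, j - m)"
      using Cons.prems entry[of i j] by (intro Cons.IH) (auto simp: na)
    then show ?thesis using 2 Cons.prems entry[of i i] entry[of j j] by (auto simp: na)
  qed
qed simp

text \<open>In a Jordan basis of a symmetric \<open>A\<close>, a nonzero superdiagonal entry \<open>s\<close> would mean
  \<open>(A - d) q = s p\<close> for an eigenvector \<open>p\<close> to \<open>d\<close>, hence \<open>s (p \<bullet> p) = q \<bullet> (A - d) p = 0\<close>.\<close>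

lemma symmetric_diagonalizable:
  fixes A :: "real mat"
  assumes A: "A \<in> carrier_mat n n" and sym: "A\<^sup>T = A"
  obtains P Q and d :: "nat \<Rightarrow> real"
  where "P \<in> carrier_mat n n" "Q \<in> carrier_mat n n" "P * Q = 1\<^sub>m n" "Q * P = 1\<^sub>m n"
    and "\<And>j. j < n \<Longrightarrow> A *\<^sub>v col P j = d j \<cdot>\<^sub>v col P j"
    and "char_poly A = (\<Prod>r\<leftarrow>map d [0..<n]. [:- r, 1:])"
proof -
  have "A $$ (i, j) = A $$ (j, i)" if "i < n" "j < n" for i j
    using A that arg_cong[OF sym, of "\<lambda>M. M $$ (i, j)"] by auto
  then obtain as where "char_poly A = (\<Prod>a\<leftarrow>as. [:- a, 1:])"
    using symmetric_char_poly_splits[OF A] by metis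
  then obtain n_as where "jordan_nf A n_as"
    using jordan_nf_exists[OF A] by blast
  then obtain P Q where wit: "similar_mat_wit A (jordan_matrix n_as) P Q"
    by (auto simp: jordan_nf_def similar_mat_def)
  define J where "J = jordan_matrix n_as"
  note w = similar_mat_witD2[OF A wit, folded J_def]
  have n: "n = sum_list (map fst n_as)"
    using carrier_matD(1)[OF w(5)] by (simp add: J_def)
  define d where "d j = J $$ (j, j)" for j
  have "upper_triangular J"
    using jordan_matrix_upper_triangular[of _ n_as] by (simp add: upper_triangular_def J_def)
  then have "char_poly J = (\<Prod>r\<leftarrow>diag_mat J. [:- r, 1:])"
    by (rule char_poly_upper_triangular[OF w(5)])
  moreover have "char_poly A = char_poly J"
    using wit by (intro char_poly_similar) (auto simp: similar_mat_def J_def)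
  moreover have "diag_mat J = map d [0..<n]"
    using w(5) by (auto simp: diag_mat_def d_def)
  ultimately have cp: "char_poly A = (\<Prod>r\<leftarrow>map d [0..<n]. [:- r, 1:])" by simp
  have "A * P = P * J * (Q * P)"
    using w by (simp add: assoc_mult_mat[of _ n n _ n _ n])
  then have AP: "A * P = P * J" using w by simp
  have J0: "J $$ (i, j) = 0 \<or> i = j \<or> Suc i = j \<and> d i = d j" if "i < n" "j < n" for i j
    using jordan_matrix_nonzero[of i n_as j] that unfolding n J_def d_def by blast
  have colP: "col P j \<in> carrier_vec n" for j by (intro carrier_vecI) (use w(6) in simp)
  have nz: "col P j \<noteq> 0\<^sub>v n" if "j < n" for j
  proof
    assume "col P j = 0\<^sub>v n"
    then have "(Q * P) $$ (j, j) = 0" using w(6,7) that by simp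
    then show False using w(2) that by simp
  qed
  have Acol: "A *\<^sub>v col P j = vec n (\<lambda>i. \<Sum>l<n. P $$ (i, l) * J $$ (l, j))" if "j < n" for j
  proof -
    have "A *\<^sub>v col P j = col (P * J) j"
      using A w(6) that by (subst AP[symmetric]) (rule col_mult2[symmetric], auto)
    also have "\<dots> = vec n (\<lambda>i. \<Sum>l<n. P $$ (i, l) * J $$ (l, j))"
      using w(5,6) that by (intro eq_vecI) (auto simp: scalar_prod_def atLeast0LessThan)
    finally show ?thesis .
  qed
  \<comment> \<open>Induction over the columns. The first one is an eigenvector since
    \<open>J\<close> is zero below the diagonal; afterwards, column \<open>j\<close> being an
    eigenvector is what forces the superdiagonal entry over column \<open>Suc j\<close> to
    vanish.\<close>
  have eig: "A *\<^sub>v col P j = d j \<cdot>\<^sub>v col P j" if "j < n" for j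
    using that
  proof (induction j)
    case 0
    have "(\<Sum>l<n. P $$ (i, l) * J $$ (l, 0)) = d 0 * P $$ (i, 0)" for i
    proof -
      have "(\<Sum>l<n. P $$ (i, l) * J $$ (l, 0)) = (\<Sum>l\<in>{0}. P $$ (i, l) * J $$ (l, 0))"
        using 0 J0[of _ 0] by (intro sum.mono_neutral_right) auto
      then show ?thesis by (simp add: d_def)
    qed
    then show ?case using 0 w(6) by (intro eq_vecI) (auto simp: Acol)
  next
    case (Suc j)
    define s where "s = J $$ (j, Suc j)"
    have "(\<Sum>l<n. P $$ (i, l) * J $$ (l, Suc j)) = d (Suc j) * P $$ (i, Suc j) + s * P $$ (i, j)" for i
    proof -
      have "(\<Sum>l<n. P $$ (i, l) * J $$ (l, Suc j)) = (\<Sum>l\<in>{j, Suc j}. P $$ (i, l) * J $$ (l, Suc j))"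
        using Suc.prems J0[of _ "Suc j"] by (intro sum.mono_neutral_right) auto
      then show ?thesis by (simp add: d_def s_def)
    qed
    then have A1: "A *\<^sub>v col P (Suc j) = d (Suc j) \<cdot>\<^sub>v col P (Suc j) + s \<cdot>\<^sub>v col P j"
      using Suc.prems w(6) by (intro eq_vecI) (auto simp: Acol)
    have "s = 0"
    proof (rule ccontr)
      assume s: "s \<noteq> 0"
      then have dd: "d j = d (Suc j)" using J0[of j "Suc j"] Suc.prems by (auto simp: s_def)
      have "(A *\<^sub>v col P (Suc j)) \<bullet> col P j = col P (Suc j) \<bullet> (A *\<^sub>v col P j)"
        using transpose_vec_mult_scalar[OF A colP colP] unfolding sym by simp
      then have "d j * (col P (Suc j) \<bullet> col P j) + s * (col P j \<bullet> col P j) =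
          d j * (col P (Suc j) \<bullet> col P j)"
        using Suc colP dd by (simp add: A1 add_scalar_prod_distrib[of _ n])
      then have "col P j \<bullet> col P j = 0" using s by simp
      moreover have "conjugate (col P j) = col P j" by (intro eq_vecI) auto
      ultimately show False
        using conjugate_square_eq_0_vec[OF colP] nz[of j] Suc.prems by simp
    qed
    then show ?case using A1 colP by (intro eq_vecI) auto
  qed
  show ?thesis by (rule that[OF w(6,7,1,2) eig cp])
qed

section \<open>Upper bounds for the k-th eigenvalue from test spaces\<close>

text \<open>Fewer equations than unknowns: padding the system with zero rows gives a square matrix
  of determinant 0.\<close>

lemma exists_in_kernel:
  fixes M :: "nat \<Rightarrow> nat \<Rightarrow> real"
  assumes "finite I" and "card I < k"
  obtains c where "c \<in> carrier_vec k" and "c \<noteq> 0\<^sub>v k" and "\<And>i. i \<in> I \<Longrightarrow> (\<Sum>j<k. M i j * c $ j) = 0"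
proof -
  obtain f where f: "bij_betw f {..<card I} I"
    using ex_bij_betw_nat_finite[OF assms(1)] by (auto simp: atLeast0LessThan)
  define N where "N = mat k k (\<lambda>(r, j). if r < card I then M (f r) j else 0)"
  have N: "N \<in> carrier_mat k k" by (simp add: N_def)
  \<comment> \<open>Row \<open>card I\<close> exists because \<open>card I < k\<close>, and it is
    one of the padding rows.\<close>
  have "N = mat\<^sub>r k k (\<lambda>r. if r = card I then 0\<^sub>v k else row N r)"
    using assms(2) by (intro eq_matI) (auto simp: N_def)
  also have "det \<dots> = 0"
    using assms(2) N by (intro det_row_0) auto
  finally have "det N = 0" .
  then obtain c where c: "c \<in> carrier_vec k" "c \<noteq> 0\<^sub>v k" "N *\<^sub>v c = 0\<^sub>v k"
    using det_0_iff_vec_prod_zero[OF N] by blast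
  have "(\<Sum>j<k. M i j * c $ j) = 0" if "i \<in> I" for i
  proof -
    from f that have "i \<in> f ` {..<card I}" by (simp add: bij_betw_def)
    then obtain r where r: "r < card I" "i = f r" by blast
    have "(N *\<^sub>v c) $ r = (\<Sum>j<k. M i j * c $ j)"
      using r assms(2) c(1) by (auto simp: N_def scalar_prod_def atLeast0LessThan)
    then show ?thesis using c(3) r assms(2) by simp
  qed
  then show ?thesis using that c by blast
qed

text \<open>The eigenbasis from \<open>symmetric_diagonalizable\<close> is not orthonormalised, so
  scalar products of vectors given in coordinates involve the Gram matrix of the columns.\<close>

lemma scalar_prod_mult_mat_vec:
  fixes P :: "real mat"
  assumes P: "P \<in> carrier_mat n m" and v: "v \<in> carrier_vec m" and w: "w \<in> carrier_vec m"
  shows "(P *\<^sub>v v) \<bullet> (P *\<^sub>v w) = (\<Sum>i<m. \<Sum>l<m. v $ i * w $ l * (col P i \<bullet> col P l))"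
proof -
  have "(P *\<^sub>v v) \<bullet> (P *\<^sub>v w) =
      (\<Sum>r<n. (\<Sum>i<m. P $$ (r, i) * v $ i) * (\<Sum>l<m. P $$ (r, l) * w $ l))"
    using assms by (auto simp: scalar_prod_def atLeast0LessThan)
  also have "\<dots> = (\<Sum>r<n. \<Sum>i<m. \<Sum>l<m. v $ i * w $ l * (P $$ (r, i) * P $$ (r, l)))"
    by (simp add: sum_product mult_ac)
  also have "\<dots> = (\<Sum>i<m. \<Sum>l<m. \<Sum>r<n. v $ i * w $ l * (P $$ (r, i) * P $$ (r, l)))"
    by (subst sum.swap) (intro sum.cong refl sum.swap)
  also have "\<dots> = (\<Sum>i<m. \<Sum>l<m. v $ i * w $ l * (col P i \<bullet> col P l))"
    using P by (auto simp: scalar_prod_def atLeast0LessThan sum_distrib_left intro!: sum.cong)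
  finally show ?thesis .
qed

lemma proots_prod_list_linear: "proots (\<Prod>r\<leftarrow>rs. [:- r, 1:]) = mset rs" for rs :: "real list"
proof (induction rs)
  case (Cons r rs)
  have "(\<Prod>r\<leftarrow>rs. [:- r, 1:]) \<noteq> 0" for rs :: "real list"
    by (induction rs) (simp_all del: mult_pCons_left)
  then have "proots ([:- r, 1:] * (\<Prod>r\<leftarrow>rs. [:- r, 1:])) = {#r#} + mset rs"
    using Cons.IH by (subst proots_mult) auto
  then show ?case by simp
qed simp

lemma sorted_list_of_multiset_nth_le:
  fixes \<mu> :: "'a :: linorder"
  assumes "0 < k" and "k \<le> size (filter_mset (\<lambda>x. x \<le> \<mu>) M)"
  shows "sorted_list_of_multiset M ! (k - 1) \<le> \<mu>"
proof (rule ccontr)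
  define xs where "xs = sorted_list_of_multiset M"
  assume "\<not> ?thesis"
  then have gt: "xs ! (k - 1) > \<mu>" by (simp add: xs_def)
  have M: "M = mset xs" by (simp add: xs_def)
  have k: "k \<le> length (filter (\<lambda>x. x \<le> \<mu>) xs)"
    using assms(2) unfolding M by (metis mset_filter size_mset)
  have sorted: "sorted xs" by (simp add: xs_def)
  have "{i. i < length xs \<and> xs ! i \<le> \<mu>} \<subseteq> {..<k - 1}"
  proof clarify
    fix i assume i: "i < length xs" "xs ! i \<le> \<mu>"
    show "i < k - 1"
    proof (rule ccontr)
      assume "\<not> i < k - 1"
      then have "xs ! (k - 1) \<le> xs ! i" using i sorted by (intro sorted_nth_mono) auto
      then show False using gt i by simp
    qed
  qed
  then have "length (filter (\<lambda>x. x \<le> \<mu>) xs) \<le> k - 1"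
    unfolding length_filter_conv_card using card_mono[of "{..<k - 1}"] by simp
  then show False using k assms(1) by simp
qed

text \<open>One half of the Courant-Fischer principle, by counting dimensions. If fewer than
  \<open>k\<close> eigenvalues were at most \<mu>, some nonzero \<open>x\<close> in the image of
  \<open>F\<close> would have zero coordinates at all of them in the eigenbasis; its Rayleigh
  quotient would then exceed \<mu>.\<close>

lemma symmetric_kth_eigenvalue_le:
  fixes A F :: "real mat"
  assumes A: "A \<in> carrier_mat n n" and sym: "A\<^sup>T = A"
    and F: "F \<in> carrier_mat n k" and k: "0 < k"
    and inj: "\<And>c. c \<in> carrier_vec k \<Longrightarrow> F *\<^sub>v c = 0\<^sub>v n \<Longrightarrow> c = 0\<^sub>v k"
    and le: "\<And>c. c \<in> carrier_vec k \<Longrightarrow>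
      (F *\<^sub>v c) \<bullet> (A *\<^sub>v (F *\<^sub>v c)) \<le> \<mu> * ((F *\<^sub>v c) \<bullet> (F *\<^sub>v c))"
  shows "sorted_list_of_multiset (proots (char_poly A)) ! (k - 1) \<le> \<mu>"
proof -
  obtain P Q d where PQ: "P \<in> carrier_mat n n" "Q \<in> carrier_mat n n" "P * Q = 1\<^sub>m n" "Q * P = 1\<^sub>m n"
    and eig: "\<And>j. j < n \<Longrightarrow> A *\<^sub>v col P j = d j \<cdot>\<^sub>v col P j"
    and cp: "char_poly A = (\<Prod>r\<leftarrow>map d [0..<n]. [:- r, 1:])"
    using symmetric_diagonalizable[OF A sym] by blast
  define I where "I = {i. i < n \<and> d i \<le> \<mu>}"
  have "k \<le> card I"
  proof (rule ccontr)
    assume "\<not> k \<le> card I"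
    then have I: "finite I" "card I < k" by (simp_all add: I_def)
    obtain c where c: "c \<in> carrier_vec k" "c \<noteq> 0\<^sub>v k"
      and ker: "\<And>i. i \<in> I \<Longrightarrow> (\<Sum>j<k. (Q * F) $$ (i, j) * c $ j) = 0"
      using exists_in_kernel[OF I, of "\<lambda>i j. (Q * F) $$ (i, j)"] by metis
    define x where "x = F *\<^sub>v c"
    define y where "y = Q *\<^sub>v x"
    have x: "x \<in> carrier_vec n" and y: "y \<in> carrier_vec n"
      using F PQ by (auto simp: x_def y_def intro!: carrier_vecI)
    have x0: "x \<noteq> 0\<^sub>v n" using inj c by (auto simp: x_def)
    have Py: "P *\<^sub>v y = x"
      using PQ x by (simp add: y_def assoc_mult_mat_vec[of _ n n _ n, symmetric])
    have y_I: "y $ i = 0" if "i \<in> I" for i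
    proof -
      have "y = (Q * F) *\<^sub>v c" using PQ F c by (simp add: y_def x_def)
      moreover have "i < dim_row (Q * F)" using that PQ by (simp add: I_def)
      ultimately have "y $ i = row (Q * F) i \<bullet> c" by simp
      also have "\<dots> = (\<Sum>j<k. (Q * F) $$ (i, j) * c $ j)"
        using that PQ F c(1) unfolding scalar_prod_def
        by (intro sum.cong) (auto simp: I_def)
      finally have "y $ i = (\<Sum>j<k. (Q * F) $$ (i, j) * c $ j)" .
      then show ?thesis using ker that by simp
    qed
    \<comment> \<open>The Gram matrix of the eigenbasis. Symmetry of \<open>A\<close> makes
      different eigenspaces orthogonal; nothing is known inside one eigenspace.\<close>
    define G where "G i l = col P i \<bullet> col P l" for i l
    have colP: "col P j \<in> carrier_vec n" for j by (intro carrier_vecI) (use PQ in simp)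
    have G0: "G i l = 0" if "i < n" "l < n" "d i \<noteq> d l" for i l
    proof -
      have "(A *\<^sub>v col P i) \<bullet> col P l = col P i \<bullet> (A *\<^sub>v col P l)"
        using transpose_vec_mult_scalar[OF A colP colP] unfolding sym by simp
      then have "d i * G i l = d l * G i l" using that colP by (simp add: eig G_def)
      then show ?thesis using that by simp
    qed
    define dy where "dy = vec n (\<lambda>l. d l * y $ l)"
    have Ax: "A *\<^sub>v x = P *\<^sub>v dy"
    proof -
      define D where "D = mat n n (\<lambda>(i, l). if i = l then d l else 0)"
      have D: "D \<in> carrier_mat n n" by (simp add: D_def)
      have "A * P = P * D"
      proof (rule mat_col_eqI)
        fix l assume "l < dim_col (P * D)"
        then have l: "l < n" using D by simp
        have "col (P * D) l = d l \<cdot>\<^sub>v col P l"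
        proof (rule eq_vecI)
          fix i assume "i < dim_vec (d l \<cdot>\<^sub>v col P l)"
          then have i: "i < n" using PQ by simp
          have "col (P * D) l $ i = (\<Sum>r<n. P $$ (i, r) * (if r = l then d l else 0))"
            using i l PQ D by (auto simp: scalar_prod_def D_def atLeast0LessThan)
          also have "\<dots> = d l * P $$ (i, l)" using l by (simp add: if_distrib cong: if_cong)
          finally show "col (P * D) l $ i = (d l \<cdot>\<^sub>v col P l) $ i" using i l PQ by simp
        qed (use PQ D in simp)
        then show "col (A * P) l = col (P * D) l"
          using col_mult2[OF A PQ(1) l] eig[OF l] by (simp only:)
      qed (use A PQ D in auto)
      moreover have "D *\<^sub>v y = dy"
        using y by (intro eq_vecI)
          (auto simp: dy_def D_def scalar_prod_def if_distrib[of "\<lambda>z. z * _"] cong: if_cong)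
      ultimately show ?thesis
        using A PQ D y unfolding Py[symmetric]
        by (metis assoc_mult_mat_vec)
    qed
    \<comment> \<open>Since \<open>G\<close> only couples equal eigenvalues, \<open>x \<bullet> (A - \<mu>) x\<close> is the square norm of the vector \<open>P z\<close>.\<close>
    define z where "z = vec n (\<lambda>l. sqrt (d l - \<mu>) * y $ l)"
    have "x \<bullet> (A *\<^sub>v x) - \<mu> * (x \<bullet> x) = (\<Sum>i<n. \<Sum>l<n. y $ i * (d l - \<mu>) * y $ l * G i l)"
    proof -
      have "x \<bullet> (A *\<^sub>v x) = (\<Sum>i<n. \<Sum>l<n. y $ i * dy $ l * G i l)"
        using scalar_prod_mult_mat_vec[OF PQ(1) y, of dy] unfolding Ax Py by (simp add: dy_def G_def)
      moreover have "x \<bullet> x = (\<Sum>i<n. \<Sum>l<n. y $ i * y $ l * G i l)"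
        using scalar_prod_mult_mat_vec[OF PQ(1) y y] unfolding Py by (simp add: G_def)
      ultimately show ?thesis
        by (simp add: dy_def sum_distrib_left algebra_simps flip: sum_subtractf)
    qed
    also have "\<dots> = (\<Sum>i<n. \<Sum>l<n. z $ i * z $ l * G i l)"
    proof (intro sum.cong refl)
      fix i l assume il: "i \<in> {..<n}" "l \<in> {..<n}"
      show "y $ i * (d l - \<mu>) * y $ l * G i l = z $ i * z $ l * G i l"
      \<comment> \<open>When the eigenvalues agree and \<open>l\<close> is outside \<open>I\<close>,
        the two square roots multiply to \<open>d l - \<mu>\<close>. Otherwise both sides are zero,
        through \<open>G i l\<close> or \<open>y $ l\<close>; so the values of \<open>sqrt\<close>
        at negative arguments have no effect.\<close>
      proof (cases "d i = d l \<and> l \<notin> I")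
        case True
        then have "sqrt (d l - \<mu>) * sqrt (d l - \<mu>) = d l - \<mu>" using il by (auto simp: I_def)
        then have "(d l - \<mu>) * (y $ i * y $ l) = z $ i * z $ l"
          using True il by (simp add: z_def)
        then show ?thesis by (simp add: ac_simps)
      next
        case False
        then show ?thesis using il G0[of i l] y_I by (auto simp: z_def)
      qed
    qed
    also have "\<dots> = (P *\<^sub>v z) \<bullet> (P *\<^sub>v z)"
      unfolding G_def by (rule scalar_prod_mult_mat_vec[symmetric, OF PQ(1)]; simp add: z_def)
    finally have "(P *\<^sub>v z) \<bullet> (P *\<^sub>v z) \<le> 0"
      using le[OF c(1)] by (simp add: x_def)
    moreover have "w \<bullet> w = (\<Sum>i<dim_vec w. (w $ i)\<^sup>2)" for w :: "real vec"
      by (simp add: scalar_prod_def power2_eq_square atLeast0LessThan)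
    ultimately have "(P *\<^sub>v z) $ i = 0" if "i < n" for i
      using that PQ sum_nonneg_eq_0_iff[of "{..<n}" "\<lambda>i. ((P *\<^sub>v z) $ i)\<^sup>2"]
        sum_nonneg[of "{..<n}" "\<lambda>i. ((P *\<^sub>v z) $ i)\<^sup>2"] by auto
    then have "P *\<^sub>v z = 0\<^sub>v n" using PQ by (intro eq_vecI) auto
    then have "(Q * P) *\<^sub>v z = 0\<^sub>v n"
      using PQ by (subst assoc_mult_mat_vec[of _ n n _ n]) (auto simp: z_def)
    then have z0: "z = 0\<^sub>v n" using PQ by (simp add: z_def)
    \<comment> \<open>\<open>I\<close> also contains the indices with \<open>d l = \<mu>\<close>, so
      outside \<open>I\<close> the square root is nonzero and \<open>z = 0\<close> gives
      \<open>y $ l = 0\<close>; inside \<open>I\<close> this holds by the choice of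
      \<open>c\<close>.\<close>
    have "y = 0\<^sub>v n"
    proof (rule eq_vecI)
      fix l assume "l < dim_vec (0\<^sub>v n :: real vec)"
      then have l: "l < n" by simp
      have "sqrt (d l - \<mu>) * y $ l = 0" using l arg_cong[OF z0, of "\<lambda>v. v $ l"] by (simp add: z_def)
      then show "y $ l = 0\<^sub>v n $ l" using l y_I[of l] by (auto simp: I_def)
    qed (use y in simp)
    then have "x = 0\<^sub>v n" using PQ Py by auto
    then show False using x0 by simp
  qed
  also have "card I = size (filter_mset (\<lambda>x. x \<le> \<mu>) (proots (char_poly A)))"
  proof -
    have "I = {i. i < length (map d [0..<n]) \<and> map d [0..<n] ! i \<le> \<mu>}" by (auto simp: I_def)
    then have "card I = length (filter (\<lambda>x. x \<le> \<mu>) (map d [0..<n]))"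
      unfolding length_filter_conv_card by simp
    then show ?thesis unfolding cp proots_prod_list_linear by (metis mset_filter size_mset)
  qed
  finally show ?thesis by (intro sorted_list_of_multiset_nth_le k)
qed

section \<open>Laplacian eigenvalues from sparse vertex cuts\<close>

text \<open>Twice the left-hand side is the sum of \<open>a i j * (x i - x j)^2\<close> over ordered
  pairs. Pairs with equal values contribute nothing, and for the others \<open>(x i - x j)^2\<close>
  is at most \<open>2 * (x i)^2 + 2 * (x j)^2\<close>. By symmetry both halves have the same sum,
  which yields \<open>4 * C\<close> for the doubled form.\<close>

lemma dirichlet_form_le:
  fixes a :: "nat \<Rightarrow> nat \<Rightarrow> real" and x :: "nat \<Rightarrow> real"
  assumes sym: "\<And>i j. a i j = a j i" and nonneg: "\<And>i j. a i j \<ge> 0"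
    and deg: "\<And>i. i < n \<Longrightarrow> x i \<noteq> 0 \<Longrightarrow> (\<Sum>j<n. if x i = x j then 0 else a i j) \<le> C"
  shows "(\<Sum>i<n. x i * ((\<Sum>j<n. a i j) * x i - (\<Sum>j<n. a i j * x j))) \<le> 2 * C * (\<Sum>i<n. (x i)\<^sup>2)"
proof -
  let ?b = "\<lambda>i j. if x i = x j then 0 else a i j"
  have sq: "(\<Sum>i<n. \<Sum>j<n. a i j * (x j)\<^sup>2) = (\<Sum>i<n. \<Sum>j<n. a i j * (x i)\<^sup>2)"
    by (subst sum.swap) (simp add: sym[of _ "_ :: nat"] cong: sum.cong)
  have sqb: "(\<Sum>i<n. \<Sum>j<n. ?b i j * (x j)\<^sup>2) = (\<Sum>i<n. \<Sum>j<n. ?b i j * (x i)\<^sup>2)"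
    by (subst sum.swap) (intro sum.cong refl, auto simp: sym)
  have "2 * (\<Sum>i<n. x i * ((\<Sum>j<n. a i j) * x i - (\<Sum>j<n. a i j * x j))) =
      2 * (\<Sum>i<n. \<Sum>j<n. a i j * (x i)\<^sup>2) - 2 * (\<Sum>i<n. \<Sum>j<n. a i j * (x i * x j))"
    by (simp add: right_diff_distrib sum_subtractf sum_distrib_left sum_distrib_right
        power2_eq_square mult_ac)
  also have "\<dots> = (\<Sum>i<n. \<Sum>j<n. a i j * (x i)\<^sup>2 + a i j * (x j)\<^sup>2 - 2 * (a i j * (x i * x j)))"
    by (simp add: sum_subtractf sum.distrib sq sum_distrib_left)
  also have "\<dots> \<le> (\<Sum>i<n. \<Sum>j<n. 2 * (?b i j * (x i)\<^sup>2) + 2 * (?b i j * (x j)\<^sup>2))"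
  proof (intro sum_mono)
    fix i j
    have "0 \<le> a i j * (x i + x j)\<^sup>2" using nonneg by simp
    then show "a i j * (x i)\<^sup>2 + a i j * (x j)\<^sup>2 - 2 * (a i j * (x i * x j))
        \<le> 2 * (?b i j * (x i)\<^sup>2) + 2 * (?b i j * (x j)\<^sup>2)"
      by (auto simp: power2_eq_square algebra_simps)
  qed
  also have "\<dots> = 4 * (\<Sum>i<n. \<Sum>j<n. ?b i j * (x i)\<^sup>2)"
    by (simp only: sum.distrib sum_distrib_left[symmetric] sqb)
  also have "(\<Sum>i<n. \<Sum>j<n. ?b i j * (x i)\<^sup>2) \<le> (\<Sum>i<n. C * (x i)\<^sup>2)"
  proof (rule sum_mono)
    fix i assume "i \<in> {..<n}"
    then show "(\<Sum>j<n. ?b i j * (x i)\<^sup>2) \<le> C * (x i)\<^sup>2"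
      unfolding sum_distrib_right[symmetric]
      by (cases "x i = 0") (auto intro!: mult_right_mono deg)
  qed
  finally show ?thesis by (simp add: sum_distrib_left[symmetric] mult.assoc)
qed

text \<open>The columns of \<open>F\<close> are the indicators of the sets \<open>S j\<close>;
  disjointness makes them independent, as evaluation at one representative of each set shows. The
  first conclusion ensures that \<open>laplacian_eigenvalue k G\<close> reads a genuine entry of the
  spectrum.\<close>

lemma laplacian_eigenvalue_le_of_disjoint_sets:
  fixes G :: "'a simple_graph" and S :: "nat \<Rightarrow> 'a set" and C :: nat
  assumes fin: "finite (verts G)" and k: "0 < k"
    and sub: "\<And>j. j < k \<Longrightarrow> S j \<subseteq> verts G" and ne: "\<And>j. j < k \<Longrightarrow> S j \<noteq> {}"
    and disj: "\<And>i j. i < k \<Longrightarrow> j < k \<Longrightarrow> i \<noteq> j \<Longrightarrow> S i \<inter> S j = {}"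
    and bd: "\<And>j v. j < k \<Longrightarrow> v \<in> S j \<Longrightarrow> card {w \<in> verts G. {v, w} \<in> edges G \<and> w \<notin> S j} \<le> C"
  shows "k \<le> card (verts G)" and "laplacian_eigenvalue k G \<le> 2 * C"
proof -
  define s where "s j = (SOME v. v \<in> S j)" for j
  have s: "s j \<in> S j" if "j < k" for j using ne[OF that] by (auto simp: s_def some_in_eq)
  have uniq: "i = j" if "v \<in> S i" "v \<in> S j" "i < k" "j < k" for v i j
    using disj[of i j] that by blast
  have "inj_on s {..<k}" using s uniq by (intro inj_onI) (metis lessThan_iff)
  moreover have "s ` {..<k} \<subseteq> verts G" using s sub by blast
  ultimately show "k \<le> card (verts G)" using card_inj_on_le[of s "{..<k}" "verts G"] fin by simp
  define xs where "xs = (SOME xs. distinct xs \<and> set xs = verts G)"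
  have xs: "distinct xs" "set xs = verts G"
    using someI_ex[of "\<lambda>xs. distinct xs \<and> set xs = verts G"] finite_distinct_list[OF fin]
    unfolding xs_def by blast+
  define n where "n = length xs"
  define a :: "nat \<Rightarrow> nat \<Rightarrow> real" where "a i j = (if {xs ! i, xs ! j} \<in> edges G then 1 else 0)" for i j
  have sym: "a i j = a j i" for i j by (simp add: a_def insert_commute)
  have count: "real (card {w \<in> verts G. P w}) = (\<Sum>j<n. if P (xs ! j) then 1 else 0)" for P
  proof -
    have "real (card {w \<in> verts G. P w}) = (\<Sum>w\<in>set xs. if P w then 1 else 0)"
      unfolding xs(2) using fin by (simp add: sum.If_cases Int_def)
    also have "\<dots> = (\<Sum>j<n. if P (xs ! j) then 1 else 0)"
      using bij_betw_nth[OF xs(1), of "{..<n}" "set xs"] unfolding n_def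
      by (intro sum.reindex_bij_betw[symmetric]) simp
    finally show ?thesis .
  qed
  define L where "L = laplacian_matrix G"
  have L: "L = degree_matrix G xs - adjacency_matrix G xs"
    by (simp add: L_def laplacian_matrix_def xs_def Let_def)
  have Lc: "L \<in> carrier_mat n n" by (simp add: L n_def degree_matrix_def adjacency_matrix_def minus_mat_def)
  have Lij: "L $$ (i, j) = (if i = j then \<Sum>l<n. a i l else 0) - a i j" if "i < n" "j < n" for i j
    using that by (simp add: L n_def[symmetric] degree_matrix_def adjacency_matrix_def a_def count)
  have Lsym: "L\<^sup>T = L" using Lc by (intro eq_matI) (auto simp: Lij sym)
  define F :: "real mat" where "F = mat n k (\<lambda>(i, j). if xs ! i \<in> S j then 1 else 0)"
  have F: "F \<in> carrier_mat n k" by (simp add: F_def)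
  have Fc: "(F *\<^sub>v c) $ i = (\<Sum>j<k. if xs ! i \<in> S j then c $ j else 0)"
    if "c \<in> carrier_vec k" "i < n" for c i
    using that by (auto simp: F_def scalar_prod_def atLeast0LessThan intro!: sum.cong)
  have Fc_in: "(F *\<^sub>v c) $ i = c $ j" if "c \<in> carrier_vec k" "i < n" "j < k" "xs ! i \<in> S j" for c i j
  proof -
    have "(\<Sum>j<k. if xs ! i \<in> S j then c $ j else 0) = (\<Sum>l\<in>{j}. if xs ! i \<in> S l then c $ l else 0)"
      using that uniq by (intro sum.mono_neutral_right) auto
    then show ?thesis using that by (simp add: Fc)
  qed
  have "sorted_list_of_multiset (proots (char_poly L)) ! (k - 1) \<le> 2 * C"
  proof (rule symmetric_kth_eigenvalue_le[OF Lc Lsym F k])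
    fix c :: "real vec" assume c: "c \<in> carrier_vec k"
    show "c = 0\<^sub>v k" if 0: "F *\<^sub>v c = 0\<^sub>v n"
    proof (rule eq_vecI)
      fix j assume "j < dim_vec (0\<^sub>v k :: real vec)"
      then have j: "j < k" by simp
      then have "s j \<in> set xs" using s sub xs by blast
      then obtain i where "i < n" "xs ! i = s j" unfolding n_def in_set_conv_nth by blast
      then show "c $ j = 0\<^sub>v k $ j" using Fc_in[OF c _ j, of i] s[OF j] j by (simp add: 0)
    qed (use c in simp)
    define x where "x i = (F *\<^sub>v c) $ i" for i
    have Fcarr: "F *\<^sub>v c \<in> carrier_vec n" by (intro carrier_vecI) (use F in simp)
    have "(F *\<^sub>v c) \<bullet> (L *\<^sub>v (F *\<^sub>v c)) = (\<Sum>i<n. x i * (\<Sum>j<n. L $$ (i, j) * x j))"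
      using Lc Fcarr F by (auto simp: scalar_prod_def atLeast0LessThan x_def intro!: sum.cong)
    also have "\<dots> = (\<Sum>i<n. x i * ((\<Sum>j<n. a i j) * x i - (\<Sum>j<n. a i j * x j)))"
    proof (intro sum.cong refl)
      fix i assume "i \<in> {..<n}"
      then have "(\<Sum>j<n. L $$ (i, j) * x j) =
          (\<Sum>j<n. (if i = j then (\<Sum>l<n. a i l) * x j else 0) - a i j * x j)"
        by (intro sum.cong) (auto simp: Lij left_diff_distrib)
      also have "\<dots> = (\<Sum>j<n. a i j) * x i - (\<Sum>j<n. a i j * x j)"
        using \<open>i \<in> {..<n}\<close> by (simp add: sum_subtractf)
      finally show "x i * (\<Sum>j<n. L $$ (i, j) * x j) =
          x i * ((\<Sum>j<n. a i j) * x i - (\<Sum>j<n. a i j * x j))" by simp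
    qed
    also have "\<dots> \<le> 2 * real C * (\<Sum>i<n. (x i)\<^sup>2)"
    proof (rule dirichlet_form_le)
      fix i assume i: "i < n" "x i \<noteq> 0"
      have "\<exists>j<k. xs ! i \<in> S j"
      proof (rule ccontr)
        assume "\<not> ?thesis"
        then have "x i = 0" using i c by (auto simp: x_def Fc intro!: sum.neutral)
        then show False using i by simp
      qed
      then obtain j where j: "j < k" "xs ! i \<in> S j" by blast
      \<comment> \<open>The test function has the constant value \<open>c $ j\<close> on
        \<open>S j\<close>, so an edge along which it changes must leave \<open>S j\<close>.\<close>
      have "(\<Sum>l<n. if x i = x l then 0 else a i l) \<le>
          (\<Sum>l<n. if {xs ! i, xs ! l} \<in> edges G \<and> xs ! l \<notin> S j then 1 else 0)"
        using Fc_in[OF c _ j(1)] i j by (intro sum_mono) (auto simp: a_def x_def)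
      also have "\<dots> = real (card {w \<in> verts G. {xs ! i, w} \<in> edges G \<and> w \<notin> S j})"
        by (rule count[symmetric])
      also have "\<dots> \<le> C" using bd[OF j] by simp
      finally show "(\<Sum>l<n. if x i = x l then 0 else a i l) \<le> C" .
    qed (simp_all add: sym a_def insert_commute)
    also have "(\<Sum>i<n. (x i)\<^sup>2) = (F *\<^sub>v c) \<bullet> (F *\<^sub>v c)"
      using F by (simp add: scalar_prod_def atLeast0LessThan x_def power2_eq_square)
    finally show "(F *\<^sub>v c) \<bullet> (L *\<^sub>v (F *\<^sub>v c)) \<le> real (2 * C) * ((F *\<^sub>v c) \<bullet> (F *\<^sub>v c))"
      by simp
  qed
  then show "laplacian_eigenvalue k G \<le> 2 * C"
    by (simp add: laplacian_eigenvalue_def laplacian_spectrum_def L_def)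
qed

section \<open>Centroids of cubic graphs\<close>

lemma labelled_cubic_graphsD:
  assumes "G \<in> labelled_cubic_graphs n" and "e \<in># G"
  shows "size e = 2" and "set_mset e \<subseteq> {1..n}"
  using assms by (auto simp: labelled_cubic_graphs_def)

lemma labelled_cubic_graphs_edge:
  assumes "G \<in> labelled_cubic_graphs n" and "{#u, v#} \<in># G"
  shows "u \<in> {1..n}" and "v \<in> {1..n}"
  using labelled_cubic_graphsD(2)[OF assms] by auto

lemma whitehead_move_sym: "whitehead_move G H \<Longrightarrow> whitehead_move H G"
proof (induction rule: whitehead_move.induct)
  case (two_edges u v a b R)
  then show ?case using whitehead_move.two_edges[of u v b a R] by (simp add: add_mset_commute)
next
  case (one_edge u v R)
  then show ?case using whitehead_move.one_edge[of u v R] by (simp add: add_mset_commute)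
qed

lemma connected_on_crossing:
  assumes conn: "connected_on V G" and S: "S \<subseteq> V" "S \<noteq> {}" "S \<noteq> V"
  obtains e where "e \<in># G" and "set_mset e \<inter> S \<noteq> {}" and "\<not> set_mset e \<subseteq> S"
proof -
  obtain s t where s: "s \<in> S" and t: "t \<in> V" "t \<notin> S" using S by blast
  then have "(s, t) \<in> {(x, y). {#x, y#} \<in># G}\<^sup>*"
    using conn S(1) by (auto simp: connected_on_def)
  then have "t \<notin> S \<longrightarrow> (\<exists>x y. {#x, y#} \<in># G \<and> x \<in> S \<and> y \<notin> S)"
    by (induction rule: rtrancl_induct) (use s in auto)
  then obtain x y where "{#x, y#} \<in># G" "x \<in> S" "y \<notin> S" using t by blast
  then show ?thesis using that[of "{#x, y#}"] by auto
qed

text \<open>The far side of a bridge at \<open>c\<close>: all edges between \<open>W\<close> and its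
  complement join \<open>c\<close> to the same \<open>x\<close>. Connectedness of \<open>W\<close>
  is not demanded; crossing arguments in the connected graph take its place. Edges parallel to
  \<open>{#c, x#}\<close> are excluded only by the degree of \<open>c\<close>, once it has three
  disjoint branches.\<close>

definition branch :: "multigraph \<Rightarrow> nat \<Rightarrow> nat set \<Rightarrow> bool" where
  "branch G c W \<longleftrightarrow> c \<notin> W \<and>
     (\<exists>x\<in>W. {#c, x#} \<in># G \<and>
        (\<forall>e\<in>#G. set_mset e \<subseteq> W \<or> set_mset e \<inter> W = {} \<or> e = {#c, x#}))"

text \<open>No edge leaves the set of vertices outside both branches: the edge leaving
  \<open>W\<close> ends at \<open>c\<close>, which lies in \<open>W'\<close>, and the edge leaving
  \<open>W'\<close> ends at \<open>c'\<close>, which lies in \<open>W\<close>. Since the graph is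
  connected, that set is empty.\<close>

lemma branch_opposite:
  assumes conn: "connected_on V G" and W: "branch G c W" and W': "branch G c' W'"
    and sub: "W' \<subseteq> V" and c: "c' \<in> W" "c \<in> W'" and G: "\<And>e. e \<in># G \<Longrightarrow> set_mset e \<subseteq> V"
  shows "V - W \<subseteq> W'"
proof (rule ccontr)
  assume "\<not> ?thesis"
  moreover have "V - W - W' \<noteq> V" using sub c by blast
  ultimately obtain e where e: "e \<in># G" "set_mset e \<inter> (V - W - W') \<noteq> {}" "\<not> set_mset e \<subseteq> V - W - W'"
    using connected_on_crossing[OF conn, of "V - W - W'"] by blast
  obtain x where x: "x \<in> W" "set_mset e \<subseteq> W \<or> set_mset e \<inter> W = {} \<or> e = {#c, x#}"
    using W e(1) by (auto simp: branch_def)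
  obtain x' where x': "x' \<in> W'" "set_mset e \<subseteq> W' \<or> set_mset e \<inter> W' = {} \<or> e = {#c', x'#}"
    using W' e(1) by (auto simp: branch_def)
  have "e \<noteq> {#c, x#}" "e \<noteq> {#c', x'#}" using e(2) x(1) x'(1) c by auto
  then have "set_mset e \<inter> W = {}" "set_mset e \<inter> W' = {}" using x x' e(2) by auto
  then show False using e(3) G[OF e(1)] by blast
qed

text \<open>If \<open>W - W'\<close> were nonempty, an edge crossing its boundary could only be the
  connecting edge of \<open>W\<close>, so its end \<open>x\<close> would be outside
  \<open>W'\<close>. Then no edge could cross the boundary of \<open>W \<inter> W'\<close>. Applied
  in both directions, this makes branches at \<open>c\<close> that meet equal.\<close>

lemma branch_subset:
  assumes conn: "connected_on V G" and W: "branch G c W" and W': "branch G c W'"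
    and sub: "W \<subseteq> V" and c: "c \<in> V" and meet: "W \<inter> W' \<noteq> {}"
  shows "W \<subseteq> W'"
proof (rule ccontr)
  assume ns: "\<not> W \<subseteq> W'"
  have cW: "c \<notin> W" using W by (simp add: branch_def)
  obtain x where x: "x \<in> W" "\<forall>e\<in>#G. set_mset e \<subseteq> W \<or> set_mset e \<inter> W = {} \<or> e = {#c, x#}"
    using W by (auto simp: branch_def)
  obtain x' where x': "x' \<in> W'" "\<forall>e\<in>#G. set_mset e \<subseteq> W' \<or> set_mset e \<inter> W' = {} \<or> e = {#c, x'#}"
    using W' by (auto simp: branch_def)
  obtain e where e: "e \<in># G" "set_mset e \<inter> (W - W') \<noteq> {}" "\<not> set_mset e \<subseteq> W - W'"
    using connected_on_crossing[OF conn, of "W - W'"] ns sub cW c by blast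
  have "e \<noteq> {#c, x'#}" using e(2) x'(1) cW by auto
  then have "set_mset e \<inter> W' = {}" using x'(2) e(1,2) by blast
  then have "\<not> set_mset e \<subseteq> W" using e(3) by blast
  then have ex: "e = {#c, x#}" using x(2) e(1,2) by blast
  have xW': "x \<notin> W'" using e(2) cW unfolding ex by auto
  obtain f where f: "f \<in># G" "set_mset f \<inter> (W \<inter> W') \<noteq> {}" "\<not> set_mset f \<subseteq> W \<inter> W'"
    using connected_on_crossing[OF conn, of "W \<inter> W'"] meet sub cW c by blast
  have "f \<noteq> {#c, x#}" using f(2) xW' cW by auto
  then have fW: "set_mset f \<subseteq> W" using x(2) f(1,2) by blast
  then have "f \<noteq> {#c, x'#}" using cW by auto
  then have "set_mset f \<subseteq> W'" using x'(2) f(1,2) by blast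
  then show False using f(3) fW by blast
qed

definition tripod :: "nat \<Rightarrow> multigraph \<Rightarrow> nat \<Rightarrow> nat set \<Rightarrow> nat set \<Rightarrow> nat set \<Rightarrow> bool" where
  "tripod n G c X Y Z \<longleftrightarrow>
     insert c (X \<union> Y \<union> Z) = {1..n} \<and> X \<inter> Y = {} \<and> X \<inter> Z = {} \<and> Y \<inter> Z = {} \<and>
     branch G c X \<and> branch G c Y \<and> branch G c Z"

lemma tripod_rotate: "tripod n G c X Y Z \<Longrightarrow> tripod n G c Y Z X"
  unfolding tripod_def by blast

lemma tripod_card:
  assumes "tripod n G c X Y Z"
  shows "n = Suc (card X + card Y + card Z)"
proof -
  have fin: "finite X" "finite Y" "finite Z"
    using assms finite_subset[of _ "{1..n}"] by (auto simp: tripod_def)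
  have "n = card (insert c (X \<union> Y \<union> Z))" using assms by (simp add: tripod_def)
  also have "\<dots> = Suc (card (X \<union> Y \<union> Z))"
    using fin assms by (subst card_insert_disjoint) (auto simp: tripod_def branch_def)
  also have "card (X \<union> Y \<union> Z) = card X + card Y + card Z"
    using fin assms by (subst card_Un_disjoint, auto simp: tripod_def)+
  finally show ?thesis by simp
qed

text \<open>The branch \<open>X\<close> carries no explicit bound by \<open>n / 2\<close>; where
  uniqueness of the centre is needed, the bound comes from taking \<open>n\<close> large compared to
  \<open>p\<close>.\<close>

definition tripod_graphs :: "nat \<Rightarrow> nat \<Rightarrow> multigraph set" where
  "tripod_graphs n p = {G \<in> labelled_cubic_graphs n.
     \<exists>c X Y Z. tripod n G c X Y Z \<and> card X = p \<and> 2 * card Y < n \<and> 2 * card Z < n}"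

lemma tripod_graphsI:
  assumes "G \<in> labelled_cubic_graphs n" and "tripod n G c X Y Z"
    and "card X = p" and "2 * card Y < n" and "2 * card Z < n"
  shows "G \<in> tripod_graphs n p"
  unfolding tripod_graphs_def using assms by blast

text \<open>A vertex whose three branches all have fewer than \<open>n / 2\<close> vertices is unique.\<close>

lemma tripod_graphs_disjoint:
  assumes G: "G \<in> tripod_graphs n p" and G': "G \<in> tripod_graphs n q" and n: "2 * (p + q + 1) \<le> n"
  shows "p = q"
proof -
  have lcg: "G \<in> labelled_cubic_graphs n" using G by (simp add: tripod_graphs_def)
  then have conn: "connected_on {1..n} G" and edges: "\<And>e. e \<in># G \<Longrightarrow> set_mset e \<subseteq> {1..n}"
    unfolding labelled_cubic_graphs_def by blast+
  obtain c X Y Z where t: "tripod n G c X Y Z" and sizes: "card X = p" "2 * card Y < n" "2 * card Z < n"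
    using G unfolding tripod_graphs_def by blast
  obtain c' X' Y' Z' where t': "tripod n G c' X' Y' Z'"
    and sizes': "card X' = q" "2 * card Y' < n" "2 * card Z' < n"
    using G' unfolding tripod_graphs_def by blast
  have cc: "c = c'"
  proof (rule ccontr)
    assume ne: "c \<noteq> c'"
    note V = t[unfolded tripod_def, THEN conjunct1] t'[unfolded tripod_def, THEN conjunct1]
    \<comment> \<open>Two centres would have branches \<open>W\<close> and \<open>W'\<close>
      pointing at each other. These cover all vertices, so their sizes add up to at least
      \<open>n\<close>, although each is below \<open>n / 2\<close>.\<close>
    have "c' \<in> insert c (X \<union> Y \<union> Z)" unfolding V(1) by (simp only: V(2)[symmetric] insertI1)
    then obtain W where W: "c' \<in> W" "W \<in> {X, Y, Z}" using ne by blast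
    have "c \<in> insert c' (X' \<union> Y' \<union> Z')" unfolding V(2) by (simp only: V(1)[symmetric] insertI1)
    then obtain W' where W': "c \<in> W'" "W' \<in> {X', Y', Z'}" using ne by blast
    have b: "branch G c W" "branch G c' W'" using W(2) W'(2) t t' unfolding tripod_def by blast+
    have "W \<subseteq> insert c (X \<union> Y \<union> Z)" "W' \<subseteq> insert c' (X' \<union> Y' \<union> Z')" using W(2) W'(2) by blast+
    then have sub: "W \<subseteq> {1..n}" "W' \<subseteq> {1..n}" unfolding V by simp_all
    have "{1..n} - W \<subseteq> W'" by (rule branch_opposite[OF conn b sub(2) W(1) W'(1) edges])
    moreover have fin: "finite W" "finite W'" using sub by (auto intro: finite_subset)
    ultimately have "card ({1..n} - W) \<le> card W'" by (intro card_mono)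
    then have "n - card W \<le> card W'" using sub fin by (simp add: card_Diff_subset)
    moreover have "2 * card W < n" using W(2) sizes n by (elim insertE) simp_all
    moreover have "2 * card W' < n" using W'(2) sizes' n by (elim insertE) simp_all
    ultimately show False by linarith
  qed
  have X: "branch G c X" "X \<subseteq> {1..n}" "c \<in> {1..n}" using t unfolding tripod_def by blast+
  have eq: "X = W'" if W': "W' \<in> {X', Y', Z'}" "X \<inter> W' \<noteq> {}" for W'
  proof
    have b: "branch G c W'" "W' \<subseteq> {1..n}" using t' W'(1) unfolding tripod_def cc by blast+
    show "X \<subseteq> W'" by (rule branch_subset[OF conn X(1) b(1) X(2,3) W'(2)])
    show "W' \<subseteq> X" using W'(2) by (intro branch_subset[OF conn b(1) X(1) b(2) X(3)]) blast
  qed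
  obtain x where x: "x \<in> X" using X(1) unfolding branch_def by blast
  have V: "insert c (X' \<union> Y' \<union> Z') = {1..n}" using t' unfolding tripod_def cc by (rule conjunct1)
  have "x \<in> insert c (X' \<union> Y' \<union> Z')" unfolding V using x X(2) by (rule subsetD[rotated])
  moreover have "x \<noteq> c" using x X(1) unfolding branch_def by blast
  ultimately obtain W' where W': "W' \<in> {X', Y', Z'}" "x \<in> W'" by blast
  then have "X = W'" using x by (intro eq) auto
  then have "card X = card X' \<or> card X = card Y' \<or> card X = card Z'" using W'(1) by blast
  \<comment> \<open>If \<open>X\<close> were \<open>Y'\<close> or \<open>Z'\<close>, two primed
    branches would have sizes \<open>p\<close> and \<open>q\<close>, and the third
    \<open>n - 1 - p - q\<close>. The assumption on \<open>n\<close> makes this at least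
    \<open>n / 2\<close>, a contradiction.\<close>
  then show ?thesis
  proof (elim disjE)
    assume "card X = card Y'"
    then have False using sizes sizes' n tripod_card[OF t'] by simp
    then show ?thesis ..
  next
    assume "card X = card Z'"
    then have False using sizes sizes' n tripod_card[OF t'] by simp
    then show ?thesis ..
  qed (use sizes sizes' in simp)
qed

section \<open>Balls around the centre and the effect of a move on a tripod\<close>

definition nbhd :: "multigraph \<Rightarrow> nat set \<Rightarrow> nat set" where
  "nbhd G S = S \<union> {y. \<exists>x\<in>S. {#x, y#} \<in># G}"

lemma card_incident_le_degree: "card {e. e \<in># G \<and> x \<in># e} \<le> vertex_degree G x"
proof (induction G)
  case (add e G)
  show ?case
  proof (cases "x \<in># e")
    case True
    then have "{f. f \<in># add_mset e G \<and> x \<in># f} = insert e {f. f \<in># G \<and> x \<in># f}" by auto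
    moreover have "finite {f. f \<in># G \<and> x \<in># f}" by simp
    ultimately have "card {f. f \<in># add_mset e G \<and> x \<in># f} \<le> Suc (card {f. f \<in># G \<and> x \<in># f})"
      by (simp add: card_insert_if)
    moreover have "count e x \<ge> 1" using True by simp
    moreover have "vertex_degree (add_mset e G) x = count e x + vertex_degree G x"
      by (simp add: vertex_degree_def)
    ultimately show ?thesis using add.IH by linarith
  next
    case False
    then have "{f. f \<in># add_mset e G \<and> x \<in># f} = {f. f \<in># G \<and> x \<in># f}" by auto
    then show ?thesis using add by (simp add: vertex_degree_def)
  qed
qed (simp add: vertex_degree_def)

text \<open>Each vertex contributes itself and at most three neighbours.\<close>

lemma nbhd_bound:
  assumes G: "G \<in> labelled_cubic_graphs n" and S: "finite S"
  shows "finite (nbhd G S)" and "card (nbhd G S) \<le> 4 * card S"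
proof -
  have N: "finite {y. {#x, y#} \<in># G} \<and> card {y. {#x, y#} \<in># G} \<le> 3" for x
  proof -
    have inj: "inj_on (\<lambda>y. {#x, y#}) {y. {#x, y#} \<in># G}" by (auto intro: inj_onI)
    have sub: "(\<lambda>y. {#x, y#}) ` {y. {#x, y#} \<in># G} \<subseteq> {e. e \<in># G \<and> x \<in># e}" by auto
    have "finite {y. {#x, y#} \<in># G}" using inj_on_finite[OF inj sub] by simp
    moreover have "card {y. {#x, y#} \<in># G} \<le> 3"
    proof (cases "x \<in> {1..n}")
      case True
      then have "vertex_degree G x = 3" using G by (simp add: labelled_cubic_graphs_def)
      then show ?thesis using card_inj_on_le[OF inj sub] card_incident_le_degree[of G x] by simp
    next
      case False
      then have "{y. {#x, y#} \<in># G} = {}" using labelled_cubic_graphs_edge[OF G] by blast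
      then show ?thesis by simp
    qed
    ultimately show ?thesis by blast
  qed
  have eq: "nbhd G S = S \<union> (\<Union>x\<in>S. {y. {#x, y#} \<in># G})" by (auto simp: nbhd_def)
  show "finite (nbhd G S)" unfolding eq using N S by blast
  have "card (nbhd G S) \<le> card S + card (\<Union>x\<in>S. {y. {#x, y#} \<in># G})"
    unfolding eq by (rule card_Un_le)
  also have "card (\<Union>x\<in>S. {y. {#x, y#} \<in># G}) \<le> (\<Sum>x\<in>S. card {y. {#x, y#} \<in># G})"
    by (rule card_UN_le[OF S])
  also have "\<dots> \<le> (\<Sum>x\<in>S. 3)" using N by (intro sum_mono) blast
  finally show "card (nbhd G S) \<le> 4 * card S" by simp
qed

text \<open>The connecting edge of \<open>W\<close> is not among the removed edges \<open>A\<close>,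
  so it survives in \<open>R\<close>, and no new edge crosses the boundary of \<open>W\<close>.
  Serves both for Whitehead moves and for growing trees.\<close>

lemma branch_replace:
  assumes b: "branch (A + R) c W" and disj: "\<And>x. x \<in> W \<Longrightarrow> {#c, x#} \<notin># A"
    and B: "\<And>e. e \<in># B \<Longrightarrow> set_mset e \<subseteq> W \<or> set_mset e \<inter> W = {}"
  shows "branch (B + R) c W"
proof -
  obtain x where x: "x \<in> W" "{#c, x#} \<in># A + R"
    "\<forall>e\<in>#A + R. set_mset e \<subseteq> W \<or> set_mset e \<inter> W = {} \<or> e = {#c, x#}"
    using b by (auto simp: branch_def)
  have "{#c, x#} \<in># R" using x(1,2) disj by auto
  then have "\<exists>x\<in>W. {#c, x#} \<in># B + R \<and>
      (\<forall>e\<in>#B + R. set_mset e \<subseteq> W \<or> set_mset e \<inter> W = {} \<or> e = {#c, x#})"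
    using x(1,3) B by (intro bexI[of _ x]) auto
  then show ?thesis using b by (simp add: branch_def)
qed

text \<open>The three edges of the move avoid \<open>c\<close>, so none of them connects a branch to
  \<open>c\<close>. Each therefore lies on one side of every branch, and the path \<open>a\<close>,
  \<open>u\<close>, \<open>v\<close>, \<open>b\<close> puts all four vertices on the same side; the
  new edges use only these vertices.\<close>

lemma whitehead_move_tripod:
  assumes t: "tripod n ({#{#u, v#}, {#u, a#}, {#v, b#}#} + R) c X Y Z" and uv: "u \<noteq> v"
    and V: "u \<in> {1..n}" "v \<in> {1..n}" and c: "c \<notin> {u, v, a, b}"
  shows "tripod n ({#{#u, v#}, {#v, a#}, {#u, b#}#} + R) c X Y Z"
proof -
  let ?A = "{#{#u, v#}, {#u, a#}, {#v, b#}#}" and ?B = "{#{#u, v#}, {#v, a#}, {#u, b#}#}"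
  have cn: "c \<noteq> u" "c \<noteq> v" "c \<noteq> a" "c \<noteq> b" using c by auto
  have ne: "{#c, x#} \<noteq> {#s, t#}" if "c \<noteq> s" "c \<noteq> t" for x s t
  proof
    assume "{#c, x#} = {#s, t#}"
    moreover have "c \<in># {#c, x#}" by simp
    ultimately have "c \<in># {#s, t#}" by (rule subst)
    then show False using that by simp
  qed
  have br: "branch (?B + R) c W" if W: "branch (?A + R) c W" for W
  proof (rule branch_replace[OF W])
    show "{#c, x#} \<notin># ?A" for x
      using ne[of u v x] ne[of u a x] ne[of v b x] cn by simp
    obtain x where x: "\<forall>e\<in>#?A + R. set_mset e \<subseteq> W \<or> set_mset e \<inter> W = {} \<or> e = {#c, x#}"
      using W unfolding branch_def by blast
    have x': "set_mset e \<subseteq> W \<or> set_mset e \<inter> W = {}" if "e \<in># ?A" "e \<noteq> {#c, x#}" for e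
      using bspec[OF x, of e] that by (metis union_iff)
    have "set_mset {#u, v#} \<subseteq> W \<or> set_mset {#u, v#} \<inter> W = {}"
      "set_mset {#u, a#} \<subseteq> W \<or> set_mset {#u, a#} \<inter> W = {}"
      "set_mset {#v, b#} \<subseteq> W \<or> set_mset {#v, b#} \<inter> W = {}"
      using cn by (intro x' ne[symmetric]; simp)+
    then have "u \<in> W \<and> v \<in> W \<and> a \<in> W \<and> b \<in> W \<or> u \<notin> W \<and> v \<notin> W \<and> a \<notin> W \<and> b \<notin> W"
      by auto
    then show "set_mset e \<subseteq> W \<or> set_mset e \<inter> W = {}" if "e \<in># ?B" for e
      using that by (elim disjE) auto
  qed
  show ?thesis using t by (simp only: tripod_def br simp_thms)
qed

section \<open>Moves leaving a centroid type\<close>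

lemma card_escaping_moves:
  assumes G: "G \<in> tripod_graphs n p"
  defines "M \<equiv> {H \<in> labelled_cubic_graphs n. whitehead_move G H \<and> H \<notin> tripod_graphs n p}"
  shows "card M \<le> 64 ^ 4"
proof -
  have lcg: "G \<in> labelled_cubic_graphs n" using G by (simp add: tripod_graphs_def)
  obtain c X Y Z where t: "tripod n G c X Y Z"
    and sizes: "card X = p" "2 * card Y < n" "2 * card Z < n"
    using G unfolding tripod_graphs_def by blast
  \<comment> \<open>From any vertex of the path \<open>a\<close>, \<open>u\<close>,
    \<open>v\<close>, \<open>b\<close>, three rounds of neighbours reach all of it. Each round
    enlarges the set at most fourfold, so \<open>B\<close> has at most \<open>4^3 = 64\<close>
    elements.\<close>
  define B where "B = nbhd G (nbhd G (nbhd G {c}))"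
  have B: "finite B" "card B \<le> 64"
  proof -
    have "finite (nbhd G {c})" "card (nbhd G {c}) \<le> 4" using nbhd_bound[OF lcg, of "{c}"] by simp_all
    then have "finite (nbhd G (nbhd G {c}))" "card (nbhd G (nbhd G {c})) \<le> 16"
      using nbhd_bound[OF lcg, of "nbhd G {c}"] by simp_all
    then show "finite B" "card B \<le> 64"
      using nbhd_bound[OF lcg, of "nbhd G (nbhd G {c})"] by (simp_all add: B_def)
  qed
  define f where "f = (\<lambda>(u, v, a, b).
    G - {#{#u, v#}, {#u, a#}, {#v, b#}#} + {#{#u, v#}, {#v, a#}, {#u, b#}#})"
  \<comment> \<open>An escaping move has \<open>c\<close> among \<open>u\<close>, \<open>v\<close>,
    \<open>a\<close>, \<open>b\<close>, and its result is determined by that quadruple. Moves by the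
    rule \<open>one_edge\<close> return \<open>G\<close> itself and so never escape.\<close>
  have "M \<subseteq> f ` (B \<times> B \<times> B \<times> B)"
  proof
    fix H assume "H \<in> M"
    then have H: "H \<in> labelled_cubic_graphs n" "H \<notin> tripod_graphs n p" and "whitehead_move G H"
      by (simp_all add: M_def)
    from this(3) show "H \<in> f ` (B \<times> B \<times> B \<times> B)"
    proof cases
      case (two_edges u v a b R)
      have uv: "u \<in> {1..n}" "v \<in> {1..n}" using labelled_cubic_graphs_edge[OF lcg, of u v] two_edges by simp_all
      have "c \<in> {u, v, a, b}"
      proof (rule ccontr)
        assume "c \<notin> {u, v, a, b}"
        then have "tripod n H c X Y Z"
          using whitehead_move_tripod[OF t[unfolded two_edges(1)] two_edges(3) uv] two_edges(2) by simp
        then show False using H(2) tripod_graphsI[OF H(1) _ sizes] by blast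
      qed
      moreover have "{#u, v#} \<in># G" "{#v, u#} \<in># G" "{#u, a#} \<in># G" "{#a, u#} \<in># G" "{#v, b#} \<in># G" "{#b, v#} \<in># G"
        using two_edges by (simp_all add: add_mset_commute)
      ultimately have "u \<in> B" "v \<in> B" "a \<in> B" "b \<in> B"
        unfolding B_def nbhd_def by blast+
      moreover have "H = f (u, v, a, b)" using two_edges by (simp add: f_def)
      ultimately show ?thesis by blast
    next
      case (one_edge u v R)
      then have "H = G" by (simp add: add_mset_commute)
      then show ?thesis using G H(2) by simp
    qed
  qed
  then have "card M \<le> card (B \<times> B \<times> B \<times> B)" using B(1) by (intro surj_card_le) auto
  also have "\<dots> = card B ^ 4" by (simp add: card_cartesian_product power4_eq_xxxx)
  also have "\<dots> \<le> 64 ^ 4" using B(2) by (rule power_mono) simp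
  finally show ?thesis .
qed

section \<open>Invariance under relabelling\<close>

lemma vertex_degree_image:
  assumes "inj_on \<pi> V" and "\<forall>e\<in>#G. set_mset e \<subseteq> V" and "v \<in> V"
  shows "vertex_degree (image_mset (image_mset \<pi>) G) (\<pi> v) = vertex_degree G v"
  using assms(2)
proof (induction G)
  case (add e G)
  have "count (image_mset \<pi> e) (\<pi> v) = count e v"
  proof -
    have "set_mset e \<subseteq> V" using add.prems by simp
    then have "\<pi> -` {\<pi> v} \<inter> set_mset e = {v} \<inter> set_mset e"
      using inj_onD[OF assms(1) _ _ assms(3)] by blast
    then show ?thesis by (cases "v \<in># e") (simp_all add: count_image_mset not_in_iff)
  qed
  then show ?case using add by (simp add: vertex_degree_def)
qed (simp add: vertex_degree_def)

lemma labelled_cubic_graphs_image: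
  assumes G: "G \<in> labelled_cubic_graphs n" and \<pi>: "bij_betw \<pi> {1..n} {1..n}"
  shows "image_mset (image_mset \<pi>) G \<in> labelled_cubic_graphs n"
proof -
  let ?H = "image_mset (image_mset \<pi>) G"
  have im: "\<pi> ` {1..n} = {1..n}" and inj: "inj_on \<pi> {1..n}" using \<pi> by (auto simp: bij_betw_def)
  have pre: "\<exists>v\<in>{1..n}. w = \<pi> v" if "w \<in> {1..n}" for w
    using that unfolding im[symmetric, THEN eqset_imp_iff, of w] image_iff .
  have 1: "size e = 2 \<and> set_mset e \<subseteq> {1..n}" if "e \<in># ?H" for e
  proof -
    obtain f where f: "f \<in># G" "e = image_mset \<pi> f" using \<open>e \<in># ?H\<close> by auto
    have "set_mset e \<subseteq> \<pi> ` {1..n}" using labelled_cubic_graphsD(2)[OF G f(1)] f(2) by auto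
    then show ?thesis using labelled_cubic_graphsD(1)[OF G f(1)] f(2) im by simp
  qed
  have 2: "vertex_degree ?H w = 3" if w: "w \<in> {1..n}" for w
  proof -
    obtain v where v: "v \<in> {1..n}" "w = \<pi> v" using pre[OF w] by blast
    have "vertex_degree ?H w = vertex_degree G v"
      unfolding v(2) using G inj v(1) by (intro vertex_degree_image) (auto simp: labelled_cubic_graphs_def)
    then show ?thesis using G v(1) by (simp add: labelled_cubic_graphs_def)
  qed
  have step: "(\<pi> x, \<pi> y) \<in> {(x, y). {#x, y#} \<in># ?H}\<^sup>*" if "(x, y) \<in> {(x, y). {#x, y#} \<in># G}\<^sup>*" for x y
    using that
  proof (induction rule: rtrancl_induct)
    case (step y z)
    then have "image_mset \<pi> {#y, z#} \<in># ?H" unfolding set_image_mset by (intro imageI) simp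
    then have "(\<pi> y, \<pi> z) \<in> {(x, y). {#x, y#} \<in># ?H}" by simp
    with step.IH show ?case by (rule rtrancl_into_rtrancl)
  qed simp
  have 3: "(w, w') \<in> {(x, y). {#x, y#} \<in># ?H}\<^sup>*" if w: "w \<in> {1..n}" and w': "w' \<in> {1..n}" for w w'
  proof -
    obtain v where v: "v \<in> {1..n}" "w = \<pi> v" using pre[OF w] by blast
    obtain v' where v': "v' \<in> {1..n}" "w' = \<pi> v'" using pre[OF w'] by blast
    have "(v, v') \<in> {(x, y). {#x, y#} \<in># G}\<^sup>*"
      using G v(1) v'(1) unfolding labelled_cubic_graphs_def connected_on_def by blast
    then show ?thesis unfolding v(2) v'(2) by (rule step)
  qed
  show ?thesis
    unfolding labelled_cubic_graphs_def connected_on_def by (intro CollectI conjI ballI 1 2 3)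
qed

lemma whitehead_move_image:
  assumes "whitehead_move G H" and G: "G \<in> labelled_cubic_graphs n" and "inj_on \<pi> {1..n}"
  shows "whitehead_move (image_mset (image_mset \<pi>) G) (image_mset (image_mset \<pi>) H)"
  using assms(1)
proof cases
  case (two_edges u v a b R)
  then have "\<pi> u \<noteq> \<pi> v"
    using labelled_cubic_graphs_edge[OF G, of u v] assms(3) by (auto dest: inj_onD)
  from whitehead_move.two_edges[OF this, of "\<pi> a" "\<pi> b" "image_mset (image_mset \<pi>) R"]
  show ?thesis using two_edges by simp
next
  case (one_edge u v R)
  then have "\<pi> u \<noteq> \<pi> v"
    using labelled_cubic_graphs_edge[OF G, of u v] assms(3) by (auto dest: inj_onD)
  from whitehead_move.one_edge[OF this, of "image_mset (image_mset \<pi>) R"]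
  show ?thesis using one_edge by simp
qed

lemma branch_image:
  assumes b: "branch G c W" and inj: "inj_on \<pi> V" and V: "c \<in> V" "W \<subseteq> V" "\<forall>e\<in>#G. set_mset e \<subseteq> V"
  shows "branch (image_mset (image_mset \<pi>) G) (\<pi> c) (\<pi> ` W)"
proof -
  obtain x where c: "c \<notin> W" and x: "x \<in> W" "{#c, x#} \<in># G"
    "\<forall>e\<in>#G. set_mset e \<subseteq> W \<or> set_mset e \<inter> W = {} \<or> e = {#c, x#}"
    using b unfolding branch_def by blast
  have "\<pi> c \<notin> \<pi> ` W" using inj V c by (auto dest: inj_onD)
  moreover have "{#\<pi> c, \<pi> x#} \<in># image_mset (image_mset \<pi>) G"
    using imageI[OF x(2), of "image_mset \<pi>"] by simp
  moreover have "set_mset e \<subseteq> \<pi> ` W \<or> set_mset e \<inter> \<pi> ` W = {} \<or> e = {#\<pi> c, \<pi> x#}"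
    if e: "e \<in># image_mset (image_mset \<pi>) G" for e
  proof -
    obtain f where f: "f \<in># G" "e = image_mset \<pi> f" using e by auto
    consider "set_mset f \<subseteq> W" | "set_mset f \<inter> W = {}" | "f = {#c, x#}" using x(3) f(1) by blast
    then show ?thesis
    proof cases
      case 2
      have "\<pi> ` set_mset f \<inter> \<pi> ` W = \<pi> ` (set_mset f \<inter> W)"
        using V f(1) by (intro inj_on_image_Int[symmetric, OF inj]) auto
      then show ?thesis using 2 f(2) by simp
    qed (use f(2) in auto)
  qed
  ultimately show ?thesis using x(1) unfolding branch_def by blast
qed

text \<open>A relabelling carries the centre and its branches along and keeps their sizes. Hence the
  type of an isomorphism class can be read off any representative.\<close>

lemma tripod_graphs_image:
  assumes G: "G \<in> tripod_graphs n p" and \<pi>: "bij_betw \<pi> {1..n} {1..n}"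
  shows "image_mset (image_mset \<pi>) G \<in> tripod_graphs n p"
proof -
  let ?H = "image_mset (image_mset \<pi>) G"
  have im: "\<pi> ` {1..n} = {1..n}" and inj: "inj_on \<pi> {1..n}" using \<pi> by (auto simp: bij_betw_def)
  have lcg: "G \<in> labelled_cubic_graphs n" using G by (simp add: tripod_graphs_def)
  then have E: "\<forall>e\<in>#G. set_mset e \<subseteq> {1..n}" using labelled_cubic_graphsD(2) by blast
  obtain c X Y Z where t: "tripod n G c X Y Z"
    and sizes: "card X = p" "2 * card Y < n" "2 * card Z < n"
    using G unfolding tripod_graphs_def by blast
  note V = t[unfolded tripod_def, THEN conjunct1]
  have sub: "c \<in> {1..n}" "X \<subseteq> {1..n}" "Y \<subseteq> {1..n}" "Z \<subseteq> {1..n}"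
    unfolding V[symmetric] by auto
  have card: "card (\<pi> ` W) = card W" if "W \<subseteq> {1..n}" for W
    using inj that by (meson card_image inj_on_subset)
  have disj: "\<pi> ` W \<inter> \<pi> ` W' = {}" if "W \<inter> W' = {}" "W \<subseteq> {1..n}" "W' \<subseteq> {1..n}" for W W'
    using inj_on_image_Int[OF inj that(2,3)] that(1) by simp
  have b0: "branch G c X" "branch G c Y" "branch G c Z"
    and XYZ: "X \<inter> Y = {}" "X \<inter> Z = {}" "Y \<inter> Z = {}"
    using t by (simp_all only: tripod_def)
  note b = branch_image[OF b0(1) inj sub(1,2) E] branch_image[OF b0(2) inj sub(1,3) E]
    branch_image[OF b0(3) inj sub(1,4) E]
  have V': "insert (\<pi> c) (\<pi> ` X \<union> \<pi> ` Y \<union> \<pi> ` Z) = {1..n}"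
    by (simp only: image_insert[symmetric] image_Un[symmetric] V im)
  have tH: "tripod n ?H (\<pi> c) (\<pi> ` X) (\<pi> ` Y) (\<pi> ` Z)"
    unfolding tripod_def
    by (intro conjI V' b disj[OF XYZ(1) sub(2,3)] disj[OF XYZ(2) sub(2,4)] disj[OF XYZ(3) sub(3,4)])
  show ?thesis
    using sizes card sub by (intro tripod_graphsI[OF labelled_cubic_graphs_image[OF lcg \<pi>] tH]) simp_all
qed

section \<open>Escaping neighbours in the labelled and unlabelled graphs\<close>

lemma card_escaping_neighbours_labelled:
  assumes G: "G \<in> tripod_graphs n p"
  shows "card {H \<in> verts (Gamma_l n). {G, H} \<in> edges (Gamma_l n) \<and> H \<notin> tripod_graphs n p} \<le> 64 ^ 4"
proof -
  have "{H \<in> verts (Gamma_l n). {G, H} \<in> edges (Gamma_l n) \<and> H \<notin> tripod_graphs n p} \<subseteq>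
      {H \<in> labelled_cubic_graphs n. whitehead_move G H \<and> H \<notin> tripod_graphs n p}"
    using whitehead_move_sym[of _ G] by (auto simp: Gamma_l_def doubleton_eq_iff)
  then have "card {H \<in> verts (Gamma_l n). {G, H} \<in> edges (Gamma_l n) \<and> H \<notin> tripod_graphs n p} \<le>
      card {H \<in> labelled_cubic_graphs n. whitehead_move G H \<and> H \<notin> tripod_graphs n p}"
    by (intro card_mono) (simp_all add: finite_labelled_cubic_graphs)
  then show ?thesis using card_escaping_moves[OF G] by simp
qed

text \<open>By \<open>tripod_graphs_image\<close>, a class that meets
  \<open>tripod_graphs n p\<close> is contained in it.\<close>

definition tripod_classes :: "nat \<Rightarrow> nat \<Rightarrow> multigraph set set" where
  "tripod_classes n p = {C \<in> unlabelled_cubic_graphs n. C \<inter> tripod_graphs n p \<noteq> {}}"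

text \<open>Fix a representative \<open>G\<close> of \<open>C\<close>. A move between any
  representatives of \<open>C\<close> and \<open>D\<close> can be relabelled into a move from
  \<open>G\<close> to a member of \<open>D\<close>, so taking classes maps the escaping moves of
  \<open>G\<close> onto the escaping neighbours of \<open>C\<close>.\<close>

lemma card_escaping_neighbours_unlabelled:
  assumes C: "C \<in> tripod_classes n p"
  shows "card {D \<in> verts (Gamma_u n). {C, D} \<in> edges (Gamma_u n) \<and> D \<notin> tripod_classes n p} \<le> 64 ^ 4"
proof -
  obtain G where G: "G \<in> C" "G \<in> tripod_graphs n p" and Cu: "C \<in> unlabelled_cubic_graphs n"
    using C by (auto simp: tripod_classes_def)
  define M where "M = {H \<in> labelled_cubic_graphs n. whitehead_move G H \<and> H \<notin> tripod_graphs n p}"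
  have fin: "finite M" unfolding M_def using finite_labelled_cubic_graphs by simp
  have "{D \<in> verts (Gamma_u n). {C, D} \<in> edges (Gamma_u n) \<and> D \<notin> tripod_classes n p} \<subseteq>
      (\<lambda>H. iso_rel n `` {H}) ` M"
  proof
    fix D assume "D \<in> {D \<in> verts (Gamma_u n). {C, D} \<in> edges (Gamma_u n) \<and> D \<notin> tripod_classes n p}"
    then have Du: "D \<in> unlabelled_cubic_graphs n" and Dt: "D \<notin> tripod_classes n p"
      and "(\<exists>G'\<in>C. \<exists>H\<in>D. whitehead_move G' H) \<or> (\<exists>H\<in>D. \<exists>G'\<in>C. whitehead_move H G')"
      by (auto simp: Gamma_u_def doubleton_eq_iff)
    then obtain G' H where G': "G' \<in> C" and H: "H \<in> D" and move: "whitehead_move G' H"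
      using whitehead_move_sym by metis
    have "(G', G) \<in> iso_rel n"
      using quotient_eq_iff[OF equiv_iso_rel] Cu G(1) G' unfolding unlabelled_cubic_graphs_def by blast
    then obtain \<pi> where \<pi>: "bij_betw \<pi> {1..n} {1..n}" "G = image_mset (image_mset \<pi>) G'"
      and G'l: "G' \<in> labelled_cubic_graphs n"
      by (auto simp: iso_rel_def)
    define K where "K = image_mset (image_mset \<pi>) H"
    have Hl: "H \<in> labelled_cubic_graphs n"
      using H Du in_quotient_imp_subset[OF equiv_iso_rel] unfolding unlabelled_cubic_graphs_def by blast
    have Kl: "K \<in> labelled_cubic_graphs n"
      unfolding K_def by (rule labelled_cubic_graphs_image[OF Hl \<pi>(1)])
    then have HK: "(H, K) \<in> iso_rel n" using Hl \<pi>(1) by (auto simp: iso_rel_def K_def)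
    have Dq: "D \<in> labelled_cubic_graphs n // iso_rel n"
      using Du by (simp add: unlabelled_cubic_graphs_def)
    have KD: "K \<in> D" by (rule in_quotient_imp_closed[OF equiv_iso_rel Dq H HK])
    have D: "D = iso_rel n `` {K}"
    proof -
      obtain L where L: "D = iso_rel n `` {L}" using Dq by (rule quotientE)
      then have "(L, K) \<in> iso_rel n" using KD by simp
      then show ?thesis unfolding L by (rule equiv_class_eq[OF equiv_iso_rel])
    qed
    have "whitehead_move G K"
      unfolding \<pi>(2) K_def using \<pi>(1) by (intro whitehead_move_image[OF move G'l]) (simp add: bij_betw_def)
    moreover have "K \<notin> tripod_graphs n p" using KD Du Dt by (auto simp: tripod_classes_def)
    ultimately show "D \<in> (\<lambda>H. iso_rel n `` {H}) ` M" using Kl D by (auto simp: M_def)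
  qed
  then have "card {D \<in> verts (Gamma_u n). {C, D} \<in> edges (Gamma_u n) \<and> D \<notin> tripod_classes n p} \<le> card M"
    using fin by (rule surj_card_le[rotated])
  then show ?thesis using card_escaping_moves[OF G(2)] by (simp add: M_def)
qed

lemma tripod_classes_disjoint:
  assumes "C \<in> tripod_classes n p" and "C \<in> tripod_classes n q" and "2 * (p + q + 1) \<le> n"
  shows "p = q"
proof -
  obtain G H where G: "G \<in> C" "G \<in> tripod_graphs n p" and H: "H \<in> C" "H \<in> tripod_graphs n q"
    and "C \<in> unlabelled_cubic_graphs n"
    using assms by (auto simp: tripod_classes_def)
  then have "(G, H) \<in> iso_rel n"
    using quotient_eq_iff[OF equiv_iso_rel] unfolding unlabelled_cubic_graphs_def by blast
  then have "H \<in> tripod_graphs n p" using tripod_graphs_image[OF G(2)] by (auto simp: iso_rel_def)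
  then show ?thesis using tripod_graphs_disjoint H(2) assms(3) by blast
qed

lemma tripod_classes_nonempty:
  assumes "tripod_graphs n p \<noteq> {}"
  shows "tripod_classes n p \<noteq> {}"
proof -
  obtain G where G: "G \<in> tripod_graphs n p" using assms by blast
  then have l: "G \<in> labelled_cubic_graphs n" by (simp add: tripod_graphs_def)
  have "iso_rel n `` {G} \<in> unlabelled_cubic_graphs n"
    unfolding unlabelled_cubic_graphs_def by (rule quotientI[OF l])
  moreover have "G \<in> iso_rel n `` {G}" by (rule equiv_class_self[OF equiv_iso_rel l])
  ultimately show ?thesis using G by (auto simp: tripod_classes_def)
qed

section \<open>Existence of centroid types\<close>

lemma vertex_degree_add_mset [simp]: "vertex_degree (add_mset e G) v = count e v + vertex_degree G v"
  by (simp add: vertex_degree_def)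

lemma connected_onI_root:
  assumes "\<And>v. v \<in> V \<Longrightarrow> (r, v) \<in> {(x, y). {#x, y#} \<in># G}\<^sup>*"
  shows "connected_on V G"
proof -
  have "sym {(x, y). {#x, y#} \<in># G}" by (auto intro: symI simp: add_mset_commute)
  then have "(v, r) \<in> {(x, y). {#x, y#} \<in># G}\<^sup>*" if "v \<in> V" for v
    using assms[OF that] by (meson symD sym_rtrancl)
  then show ?thesis using assms unfolding connected_on_def by (meson rtrancl_trans)
qed

text \<open>Cubic tripods whose branches are binary trees with loops at the leaves: a branch grows by
  two vertices when a leaf gets two children.\<close>

definition loop_tripod :: "nat \<Rightarrow> multigraph \<Rightarrow> nat \<Rightarrow> nat set \<Rightarrow> nat set \<Rightarrow> nat set \<Rightarrow> bool" where
  "loop_tripod n G c X Y Z \<longleftrightarrow> G \<in> labelled_cubic_graphs n \<and> tripod n G c X Y Z \<and>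
     (\<exists>v\<in>X. {#v, v#} \<in># G) \<and> (\<exists>v\<in>Y. {#v, v#} \<in># G) \<and> (\<exists>v\<in>Z. {#v, v#} \<in># G)"

lemma loop_tripod_rotate: "loop_tripod n G c X Y Z \<Longrightarrow> loop_tripod n G c Y Z X"
  unfolding loop_tripod_def using tripod_rotate by blast

lemma loop_tripod_grow:
  assumes "loop_tripod n G c X Y Z"
  obtains H where "loop_tripod (n + 2) H c (X \<union> {n + 1, n + 2}) Y Z"
proof -
  have lcg: "G \<in> labelled_cubic_graphs n" and t: "tripod n G c X Y Z"
    and lY: "\<exists>v\<in>Y. {#v, v#} \<in># G" and lZ: "\<exists>v\<in>Z. {#v, v#} \<in># G"
    using assms by (simp_all add: loop_tripod_def)
  obtain v where v: "v \<in> X" "{#v, v#} \<in># G" using assms by (auto simp: loop_tripod_def)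
  obtain R where R: "G = add_mset {#v, v#} R" using v(2) by (metis insert_DiffM)
  define w w' where "w = n + 1" and "w' = n + 2"
  \<comment> \<open>The loop at \<open>v\<close> counts 2 towards its degree, as do the two edges
    replacing it. Each new vertex has one tree edge and one loop, so all degrees are 3, and the new
    loops allow further growth.\<close>
  define N where "N = {#{#v, w#}, {#v, w'#}, {#w, w#}, {#w', w'#}#}"
  define H where "H = N + R"
  have Hsimp: "H = add_mset {#v, w#} (add_mset {#v, w'#} (add_mset {#w, w#} (add_mset {#w', w'#} R)))"
    by (simp add: H_def N_def)
  note V = t[unfolded tripod_def, THEN conjunct1]
  have sub: "c \<in> {1..n}" "X \<subseteq> {1..n}" "Y \<subseteq> {1..n}" "Z \<subseteq> {1..n}"
    unfolding V[symmetric] by auto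
  have vn: "v \<in> {1..n}" using v(1) sub(2) by blast
  have fresh: "w \<notin> {1..n}" "w' \<notin> {1..n}" "w \<noteq> w'" by (simp_all add: w_def w'_def)
  have Vn: "{1..n + 2} = {1..n} \<union> {w, w'}" by (auto simp: w_def w'_def)
  have edgeR: "size e = 2 \<and> set_mset e \<subseteq> {1..n}" if "e \<in># R" for e
    using labelled_cubic_graphsD[OF lcg, of e] that by (simp add: R)
  have deg0: "vertex_degree R x = 0" if "x \<notin> {1..n}" for x
    using edgeR that unfolding vertex_degree_def by (fastforce simp: not_in_iff[symmetric])
  have Hl: "H \<in> labelled_cubic_graphs (n + 2)"
  proof -
    have "size e = 2 \<and> set_mset e \<subseteq> {1..n + 2}" if "e \<in># H" for e
    proof (cases "e \<in># R")
      case True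
      then show ?thesis using edgeR unfolding Vn by blast
    next
      case False
      then show ?thesis using that vn unfolding Vn by (auto simp: Hsimp)
    qed
    moreover have "vertex_degree H x = 3" if x: "x \<in> {1..n + 2}" for x
    proof -
      have "vertex_degree G x = 3" if "x \<in> {1..n}" using lcg that by (simp add: labelled_cubic_graphs_def)
      moreover have "vertex_degree R w = 0" "vertex_degree R w' = 0" using deg0 fresh by blast+
      ultimately show ?thesis
        using x fresh vn unfolding Vn by (auto simp: Hsimp R)
    qed
    moreover have "connected_on {1..n + 2} H"
    proof (rule connected_onI_root)
      let ?E = "{(x, y). {#x, y#} \<in># H}"
      \<comment> \<open>The deleted loop relates only \<open>v\<close> to itself, so reachability in
        \<open>G\<close> survives in \<open>H\<close>.\<close>
      have "{(x, y). {#x, y#} \<in># G} \<subseteq> ?E\<^sup>*"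
      proof clarify
        fix x y assume "{#x, y#} \<in># G"
        then consider "{#x, y#} = {#v, v#}" | "{#x, y#} \<in># R" by (auto simp: R)
        then show "(x, y) \<in> ?E\<^sup>*"
        proof cases
          case 1
          then have "x = v \<and> y = v" by (auto simp: add_eq_conv_ex)
          then show ?thesis by simp
        next
          case 2
          then show ?thesis by (auto simp: H_def)
        qed
      qed
      then have G_H: "{(x, y). {#x, y#} \<in># G}\<^sup>* \<subseteq> ?E\<^sup>*" by (metis rtrancl_mono rtrancl_idemp)
      fix x assume "x \<in> {1..n + 2}"
      then consider "x \<in> {1..n}" | "x = w" | "x = w'" unfolding Vn by blast
      then show "(v, x) \<in> ?E\<^sup>*"
      proof cases
        case 1
        then have "(v, x) \<in> {(x, y). {#x, y#} \<in># G}\<^sup>*"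
          using lcg vn unfolding labelled_cubic_graphs_def connected_on_def by blast
        then show ?thesis using G_H by blast
      qed (auto simp: Hsimp)
    qed
    ultimately show ?thesis unfolding labelled_cubic_graphs_def by blast
  qed
  have bX: "branch G c X" and bY: "branch G c Y" and bZ: "branch G c Z"
    and XY: "X \<inter> Y = {}" and XZ: "X \<inter> Z = {}" and YZ: "Y \<inter> Z = {}"
    using t by (simp_all add: tripod_def)
  have cX: "c \<notin> X" using bX by (simp add: branch_def)
  have old: "branch H c W" if W: "branch G c W" "W \<subseteq> {1..n}" "v \<notin> W" for W
    unfolding H_def
  proof (rule branch_replace)
    show "branch ({#{#v, v#}#} + R) c W" using W(1) by (simp add: R)
    show "{#c, x#} \<notin># {#{#v, v#}#}" if "x \<in> W" for x
      using that W(3) by (auto simp: add_eq_conv_ex)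
    show "set_mset e \<subseteq> W \<or> set_mset e \<inter> W = {}" if "e \<in># N" for e
      using that W(2,3) fresh by (auto simp: N_def)
  qed
  have new: "branch H c (X \<union> {w, w'})"
  proof -
    obtain x where x: "x \<in> X" "{#c, x#} \<in># G"
      "\<forall>e\<in>#G. set_mset e \<subseteq> X \<or> set_mset e \<inter> X = {} \<or> e = {#c, x#}"
      using bX unfolding branch_def by blast
    have "{#c, x#} \<noteq> {#v, v#}" using cX v(1) by (auto simp: add_eq_conv_ex)
    then have "{#c, x#} \<in># H" using x(2) by (simp add: R H_def)
    moreover have "set_mset e \<subseteq> X \<union> {w, w'} \<or> set_mset e \<inter> (X \<union> {w, w'}) = {} \<or> e = {#c, x#}"
      if "e \<in># H" for e
    proof (cases "e \<in># R")
      case True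
      then have "set_mset e \<subseteq> X \<or> set_mset e \<inter> X = {} \<or> e = {#c, x#}" using x(3) by (simp add: R)
      moreover have "w \<notin># e" "w' \<notin># e" using edgeR[OF True] fresh by blast+
      ultimately show ?thesis by blast
    next
      case False
      then show ?thesis using that v(1) by (auto simp: Hsimp)
    qed
    moreover have "c \<notin> X \<union> {w, w'}" using cX sub(1) fresh by blast
    ultimately show ?thesis using x(1) unfolding branch_def by blast
  qed
  have "v \<notin> Y" "v \<notin> Z" using v(1) XY XZ by blast+
  then have bYZ: "branch H c Y" "branch H c Z" using old bY bZ sub by blast+
  have V': "insert c (X \<union> {w, w'} \<union> Y \<union> Z) = {1..n + 2}"
    unfolding Vn V[symmetric] by blast
  have disj: "(X \<union> {w, w'}) \<inter> Y = {}" "(X \<union> {w, w'}) \<inter> Z = {}" using XY XZ sub fresh by blast+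
  have tH: "tripod (n + 2) H c (X \<union> {w, w'}) Y Z"
    unfolding tripod_def by (intro conjI V' disj YZ new bYZ)
  have loop: "\<exists>u\<in>W. {#u, u#} \<in># H" if W: "\<exists>u\<in>W. {#u, u#} \<in># G" "v \<notin> W" for W
  proof -
    obtain u where u: "u \<in> W" "{#u, u#} \<in># G" using W(1) by blast
    then have "{#u, u#} \<noteq> {#v, v#}" using W(2) by (auto simp: add_eq_conv_ex)
    then show ?thesis using u by (auto simp: R H_def)
  qed
  have "\<exists>u\<in>X \<union> {w, w'}. {#u, u#} \<in># H" by (rule bexI[of _ w]) (simp_all add: Hsimp)
  then have "loop_tripod (n + 2) H c (X \<union> {w, w'}) Y Z"
    unfolding loop_tripod_def using Hl tH loop[OF lY \<open>v \<notin> Y\<close>] loop[OF lZ \<open>v \<notin> Z\<close>] by (intro conjI)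
  then show ?thesis using that by (simp add: w_def w'_def)
qed

lemma loop_tripod_grow_iterated:
  assumes "loop_tripod n G c X Y Z"
  shows "\<exists>H X'. loop_tripod (n + 2 * i) H c X' Y Z \<and> card X' = card X + 2 * i"
proof (induction i)
  case 0
  then show ?case using assms by auto
next
  case (Suc i)
  then obtain H X' where H: "loop_tripod (n + 2 * i) H c X' Y Z" and X': "card X' = card X + 2 * i"
    by blast
  let ?m = "n + 2 * i"
  obtain K where K: "loop_tripod (?m + 2) K c (X' \<union> {?m + 1, ?m + 2}) Y Z"
    by (rule loop_tripod_grow[OF H])
  have "X' \<subseteq> insert c (X' \<union> Y \<union> Z)" by blast
  also have "\<dots> = {1..?m}" using H by (simp add: loop_tripod_def tripod_def)
  finally have "X' \<subseteq> {1..?m}" .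
  then have "card (X' \<union> {?m + 1, ?m + 2}) = card X' + card {?m + 1, ?m + 2}"
    by (intro card_Un_disjoint) (auto intro: finite_subset)
  then show ?case using K X' by (intro exI[of _ K] exI[of _ "X' \<union> {?m + 1, ?m + 2}"]) simp
qed

lemma loop_tripod_base: "\<exists>G. loop_tripod 4 G 1 {2} {3} {4}"
proof -
  let ?G = "{#{#1, 2#}, {#1, 3#}, {#1, 4#}, {#2, 2#}, {#3, 3#}, {#4, 4#}#} :: multigraph"
  have V: "{1..4::nat} = {1, 2, 3, 4}" by auto
  have "connected_on {1..4} ?G"
  proof (rule connected_onI_root[of _ 1])
    fix v :: nat assume "v \<in> {1..4}"
    then have "v = 1 \<or> {#1, v#} \<in># ?G" unfolding V by auto
    then show "(1, v) \<in> {(x, y). {#x, y#} \<in># ?G}\<^sup>*" by blast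
  qed
  then have "?G \<in> labelled_cubic_graphs 4"
    unfolding labelled_cubic_graphs_def V by (simp add: vertex_degree_def)
  moreover have "branch ?G 1 {2}" "branch ?G 1 {3}" "branch ?G 1 {4}" by (simp_all add: branch_def)
  ultimately have "loop_tripod 4 ?G 1 {2} {3} {4}"
    unfolding loop_tripod_def tripod_def V by auto
  then show ?thesis by blast
qed

text \<open>Starting from a claw with loops at its leaves, each branch is grown in turn, with
  rotations bringing it to the first position. Branch sizes stay odd, as they must in a cubic graph:
  \<open>3 * card W - 1\<close> is the degree sum inside a branch.\<close>

lemma loop_tripod_exists:
  "\<exists>G c X Y Z. loop_tripod (4 + 2 * (i + j + l)) G c X Y Z \<and>
     card X = 1 + 2 * i \<and> card Y = 1 + 2 * j \<and> card Z = 1 + 2 * l"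
proof -
  obtain G where "loop_tripod 4 G 1 {2} {3} {4}" using loop_tripod_base by blast
  from loop_tripod_grow_iterated[OF this, of i] obtain G1 X
    where 1: "loop_tripod (4 + 2 * i) G1 1 X {3} {4}" "card X = 1 + 2 * i" by auto
  from loop_tripod_grow_iterated[OF loop_tripod_rotate[OF 1(1)], of j] obtain G2 Y
    where 2: "loop_tripod (4 + 2 * i + 2 * j) G2 1 Y {4} X" "card Y = 1 + 2 * j" by auto
  from loop_tripod_grow_iterated[OF loop_tripod_rotate[OF 2(1)], of l] obtain G3 Z
    where 3: "loop_tripod (4 + 2 * i + 2 * j + 2 * l) G3 1 Z X Y" "card Z = 1 + 2 * l" by auto
  have "4 + 2 * i + 2 * j + 2 * l = 4 + 2 * (i + j + l)" by simp
  then show ?thesis using loop_tripod_rotate[OF 3(1)] 1(2) 2(2) 3(2) by metis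
qed

lemma tripod_graphs_nonempty:
  assumes "even n" and i: "1 \<le> i" and n: "4 * i + 6 \<le> n"
  shows "tripod_graphs n (1 + 2 * i) \<noteq> {}"
proof -
  \<comment> \<open>The first branch takes \<open>i\<close> growth steps; the remaining
    \<open>s\<close> are split as evenly as possible between the other two.\<close>
  define s where "s = n div 2 - 2 - i"
  have ns: "n = 4 + 2 * (i + s)" and s: "i \<le> s + 1" using assms by (auto simp: s_def)
  define j where "j = s div 2"
  define l where "l = s - j"
  have jl: "s = j + l" "j \<le> l" "l \<le> j + 1" by (auto simp: j_def l_def)
  obtain G c X Y Z where G: "loop_tripod n G c X Y Z"
    and sizes: "card X = 1 + 2 * i" "card Y = 1 + 2 * j" "card Z = 1 + 2 * l"
    using loop_tripod_exists[of i j l] ns jl(1) by (auto simp: add.assoc)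
  \<comment> \<open>For \<open>Z\<close> the bound amounts to \<open>l < 1 + i + j\<close>. The
    split only gives \<open>l \<le> j + 1\<close>, so \<open>1 \<le> i\<close> is what makes it
    strict; hence sizes from 3 on.\<close>
  have "2 * card Y < n" "2 * card Z < n" using sizes ns jl i by simp_all
  then have "G \<in> tripod_graphs n (1 + 2 * i)"
    using G sizes(1) by (intro tripod_graphsI[of G n c X Y Z]) (simp_all add: loop_tripod_def)
  then show ?thesis by blast
qed

section \<open>Bounded eigenvalues\<close>

theorem theorem1p1:
  fixes k :: nat
  assumes "1 \<le> k"
  shows "\<exists>c_l c_u :: real. \<forall>\<^sub>F n in sequentially. even n \<longrightarrow>
           (k \<le> card (verts (Gamma_l n)) \<and> laplacian_eigenvalue k (Gamma_l n) \<le> c_l) \<and>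
           (k \<le> card (verts (Gamma_u n)) \<and> laplacian_eigenvalue k (Gamma_u n) \<le> c_u)"
proof (intro exI eventually_sequentiallyI impI)
  fix n assume n: "8 * k + 6 \<le> n" and even: "even n"
  \<comment> \<open>The prescribed sizes are 3, 5, ..., \<open>2 * k + 1\<close>. Two of them and 1
    add up to at most \<open>4 * k + 3\<close>, which explains the threshold
    \<open>8 * k + 6\<close>. Only this threshold depends on \<open>k\<close>; the eigenvalue bound
    \<open>2 * 64 ^ 4\<close> does not.\<close>
  let ?p = "\<lambda>j. 1 + 2 * Suc j" and ?C = "64 ^ 4 :: nat"
  have k: "0 < k" using assms by simp
  have ne: "tripod_graphs n (?p j) \<noteq> {}" if "j < k" for j
    using that n by (intro tripod_graphs_nonempty even) simp_all
  have large: "2 * (?p i + ?p j + 1) \<le> n" if "i < k" "j < k" for i j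
    using that n by simp
  have "finite (verts (Gamma_l n))" by (simp add: Gamma_l_def finite_labelled_cubic_graphs)
  note L = laplacian_eigenvalue_le_of_disjoint_sets[OF this k,
      where S = "\<lambda>j. tripod_graphs n (?p j)" and C = ?C]
  have l: "tripod_graphs n (?p j) \<subseteq> verts (Gamma_l n)" for j
    by (auto simp: Gamma_l_def tripod_graphs_def)
  have ld: "tripod_graphs n (?p i) \<inter> tripod_graphs n (?p j) = {}" if "i < k" "j < k" "i \<noteq> j" for i j
    using tripod_graphs_disjoint[OF _ _ large[OF that(1,2)]] that(3) by auto
  have "finite (verts (Gamma_u n))" by (simp add: Gamma_u_def finite_unlabelled_cubic_graphs)
  note U = laplacian_eigenvalue_le_of_disjoint_sets[OF this k,
      where S = "\<lambda>j. tripod_classes n (?p j)" and C = ?C]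
  have u: "tripod_classes n (?p j) \<subseteq> verts (Gamma_u n)" for j
    by (auto simp: Gamma_u_def tripod_classes_def)
  have ud: "tripod_classes n (?p i) \<inter> tripod_classes n (?p j) = {}" if "i < k" "j < k" "i \<noteq> j" for i j
    using tripod_classes_disjoint[OF _ _ large[OF that(1,2)]] that(3) by auto
  show "(k \<le> card (verts (Gamma_l n)) \<and> laplacian_eigenvalue k (Gamma_l n) \<le> real (2 * ?C)) \<and>
      (k \<le> card (verts (Gamma_u n)) \<and> laplacian_eigenvalue k (Gamma_u n) \<le> real (2 * ?C))"
    by (intro conjI L U l ld ne u ud tripod_classes_nonempty card_escaping_neighbours_labelled
        card_escaping_neighbours_unlabelled)
qed

end
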